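(* Let $\varepsilon_0>0$ and for each $\varepsilon\in[0,\varepsilon_0]$ let $p_\varepsilon,Q_\varepsilon$ be coefficient functions as described in the context, let $\alpha(\varepsilon),\beta(\varepsilon)\in\mathbb{C}^{2s\times 2s}$, and let $L_\varepsilon$ be the corresponding operator in $L_2(\mathcal{J},\mathbb{C}^s)$ defined in the context. Suppose that the resolvent set $\rho(L_0)$ is not empty and that, as $\varepsilon\to 0+$, the following conditions hold: (1) $\|p_\varepsilon^{-1}-p_0^{-1}\|_1\to 0$; (2) $\|p_\varepsilon^{-1}Q_\varepsilon-p_0^{-1}Q_0\|_1\to 0$; (3) $\|Q_\varepsilon p_\varepsilon^{-1}-Q_0p_0^{-1}\|_1\to 0$; (4) $\|Q_\varepsilon p_\varepsilon^{-1}Q_\varepsilon-Q_0p_0^{-1}Q_0\|_1\to 0$; (5) $\alpha(\varepsilon)\to\alpha(0)$ and $\beta(\varepsilon)\to\beta(0)$, where $\|\cdot\|_1$ is the norm in the space $L_1(\mathcal{J},\mathbb{C}^{s\times s})$. Then $L_\varepsilon$ converges to $L_0$ in the norm resolvent sense as $\varepsilon\to 0+$.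
   Context: Let $s$ be a positive integer and $\mathcal{J}=(a,b)$ a finite interval. For every $\varepsilon\in[0,\varepsilon_0]$, $p_\varepsilon,Q_\varepsilon:\mathcal{J}\to\mathbb{C}^{s\times s}$ are Lebesgue measurable matrix functions, $p_\varepsilon$ is invertible almost everywhere, and $$p_\varepsilon^{-1},\quad p_\varepsilon^{-1}Q_\varepsilon,\quad Q_\varepsilon p_\varepsilon^{-1},\quad Q_\varepsilon p_\varepsilon^{-1}Q_\varepsilon\in L_1(\mathcal{J},\mathbb{C}^{s\times s}).$$ Quasi-derivatives are defined by $$D_\varepsilon^{[0]}y=y,\qquad D_\varepsilon^{[1]}y=p_\varepsilon y'-Q_\varepsilon y,\qquad D_\varepsilon^{[2]}y=(D_\varepsilon^{[1]}y)'+Q_\varepsilon p_\varepsilon^{-1}D_\varepsilon^{[1]}y+Q_\varepsilon p_\varepsilon^{-1}Q_\varepsilon y,$$ and $l_\varepsilon[y]:=-D_\varepsilon^{[2]}y$ (a regularization of $-(p_\varepsilon y')'+Q_\varepsilon' y$). Write $L_2=L_2(\mathcal{J},\mathbb{C}^s)$. The maximal operator is $L^\varepsilon_{\max}y=l_\varepsilon[y]$ with $$\operatorname{Dom}(L^\varepsilon_{\max})=\{y\in L_2:\ y,\,D_\varepsilon^{[1]}y\in AC([a,b],\mathbb{C}^s),\ D_\varepsilon^{[2]}y\in L_2\},$$ where $AC$ denotes absolutely continuous functions (and $D_\varepsilon^{[1]}y$, defined a.e., is identified with its absolutely continuous representative). Put $\mathcal{Y}_\varepsilon(a)=(y(a),D_\varepsilon^{[1]}y(a))\in\mathbb{C}^{2s}$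 and $\mathcal{Y}_\varepsilon(b)=(y(b),D_\varepsilon^{[1]}y(b))\in\mathbb{C}^{2s}$. The operator $L_\varepsilon$ is defined by $$L_\varepsilon y=l_\varepsilon[y],\qquad \operatorname{Dom}(L_\varepsilon)=\{y\in\operatorname{Dom}(L^\varepsilon_{\max}):\ \alpha(\varepsilon)\mathcal{Y}_\varepsilon(a)+\beta(\varepsilon)\mathcal{Y}_\varepsilon(b)=0\}.$$ $L_\varepsilon$ is said to converge to $L_0$ in the norm resolvent sense if there is a number $\mu\in\rho(L_0)$ such that $\mu\in\rho(L_\varepsilon)$ for all sufficiently small $\varepsilon>0$ and $\|(L_\varepsilon-\mu)^{-1}-(L_0-\mu)^{-1}\|\to 0$ as $\varepsilon\to 0+$ (operator norm), where $\rho(L)$ denotes the resolvent set of $L$. *)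

theory Defs
  imports "HOL-Analysis.Analysis"
begin

text \<open>
  Throughout, \<open>complex^'s\<close> is the space of column vectors of dimension \<open>s = CARD('s) \<ge> 1\<close> and
  \<open>complex^'s^'s\<close> the space of \<open>s \<times> s\<close> matrices; vectors of dimension \<open>2 * s\<close> are indexed by \<open>'s + 's\<close>.
\<close>

abbreviation leb :: "real \<Rightarrow> real \<Rightarrow> real measure" where
  "leb a b \<equiv> lebesgue_on {a<..<b}"

definition L1_norm :: "real \<Rightarrow> real \<Rightarrow> (real \<Rightarrow> 'v::euclidean_space) \<Rightarrow> real" where
  "L1_norm a b f = (\<integral>t. norm (f t) \<partial>leb a b)"

text \<open>
  The elements of \<open>L2\<close> are represented by functions, not by classes of functions. Equality in \<open>L2\<close>
  is equality almost everywhere in \<open>(a, b)\<close>, and all notions below respect it where they have to.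
\<close>

definition L2 :: "real \<Rightarrow> real \<Rightarrow> (real \<Rightarrow> complex^'s) set" where
  "L2 a b = {f. f \<in> borel_measurable (leb a b) \<and> integrable (leb a b) (\<lambda>t. (norm (f t))\<^sup>2)}"

definition L2_norm :: "real \<Rightarrow> real \<Rightarrow> (real \<Rightarrow> complex^'s) \<Rightarrow> real" where
  "L2_norm a b f = sqrt (\<integral>t. (norm (f t))\<^sup>2 \<partial>leb a b)"

text \<open>
  The operator norm, written as in \<^const>\<open>onorm\<close>; for functions \<open>f\<close> vanishing almost everywhere
  the quotient is \<open>0\<close>.
\<close>

definition L2_onorm :: "real \<Rightarrow> real \<Rightarrow> ((real \<Rightarrow> complex^'s) \<Rightarrow> (real \<Rightarrow> complex^'s)) \<Rightarrow> real" where
  "L2_onorm a b T = (SUP f\<in>L2 a b. L2_norm a b (T f) / L2_norm a b f)"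

text \<open>Here \<open>division_of\<close> provides the finite families of non-overlapping closed subintervals.\<close>

definition absolutely_continuous_fun :: "real \<Rightarrow> real \<Rightarrow> (real \<Rightarrow> 'v::euclidean_space) \<Rightarrow> bool" where
  "absolutely_continuous_fun a b f \<longleftrightarrow>
     (\<forall>e>0. \<exists>d>0. \<forall>D. D division_of \<Union>D \<and> \<Union>D \<subseteq> {a..b} \<and> (\<Sum>K\<in>D. measure lborel K) < d
        \<longrightarrow> (\<Sum>K\<in>D. norm (f (Sup K) - f (Inf K))) < e)"

definition admissible_coeffs ::
    "real \<Rightarrow> real \<Rightarrow> (real \<Rightarrow> complex^'s^'s) \<Rightarrow> (real \<Rightarrow> complex^'s^'s) \<Rightarrow> bool" where
  "admissible_coeffs a b p Q \<longleftrightarrow>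
     p \<in> borel_measurable (leb a b) \<and> Q \<in> borel_measurable (leb a b) \<and>
     (AE t in leb a b. invertible (p t)) \<and>
     integrable (leb a b) (\<lambda>t. matrix_inv (p t)) \<and>
     integrable (leb a b) (\<lambda>t. matrix_inv (p t) ** Q t) \<and>
     integrable (leb a b) (\<lambda>t. Q t ** matrix_inv (p t)) \<and>
     integrable (leb a b) (\<lambda>t. Q t ** matrix_inv (p t) ** Q t)"

text \<open>
  \<open>quasi_deriv1 a b p Q y u\<close>: the quasi-derivative \<open>p y' - Q y\<close> has the absolutely continuous
  representative \<open>u\<close>, which is then unique on \<open>[a, b]\<close>.
  \<open>quasi_deriv2 a b p Q y u w\<close>: if \<open>u\<close> is that representative, then \<open>w\<close> represents the second
  quasi-derivative of \<open>y\<close>. The derivatives of \<open>y\<close> and \<open>u\<close> exist almost everywhere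
  whenever these functions are absolutely continuous.
\<close>

definition quasi_deriv1 ::
    "real \<Rightarrow> real \<Rightarrow> (real \<Rightarrow> complex^'s^'s) \<Rightarrow> (real \<Rightarrow> complex^'s^'s)
      \<Rightarrow> (real \<Rightarrow> complex^'s) \<Rightarrow> (real \<Rightarrow> complex^'s) \<Rightarrow> bool" where
  "quasi_deriv1 a b p Q y u \<longleftrightarrow>
     absolutely_continuous_fun a b u \<and>
     (AE t in leb a b. \<exists>y'. (y has_vector_derivative y') (at t) \<and>
        u t = p t *v y' - Q t *v y t)"

definition quasi_deriv2 ::
    "real \<Rightarrow> real \<Rightarrow> (real \<Rightarrow> complex^'s^'s) \<Rightarrow> (real \<Rightarrow> complex^'s^'s)
      \<Rightarrow> (real \<Rightarrow> complex^'s) \<Rightarrow> (real \<Rightarrow> complex^'s) \<Rightarrow> (real \<Rightarrow> complex^'s) \<Rightarrow> bool" where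
  "quasi_deriv2 a b p Q y u w \<longleftrightarrow>
     (AE t in leb a b. \<exists>u'. (u has_vector_derivative u') (at t) \<and>
        w t = u' + (Q t ** matrix_inv (p t)) *v u t
                 + (Q t ** matrix_inv (p t) ** Q t) *v y t)"

definition bdry_vec ::
    "(real \<Rightarrow> complex^'s) \<Rightarrow> (real \<Rightarrow> complex^'s) \<Rightarrow> real \<Rightarrow> complex^('s + 's)" where
  "bdry_vec y u c = (\<chi> i. case i of Inl j \<Rightarrow> y c $ j | Inr j \<Rightarrow> u c $ j)"

text \<open>
  Unbounded operators in \<open>L2\<close> are given by their graphs, so that \<open>(y, g) \<in> L\<close> means that \<open>y\<close> is in
  the domain of \<open>L\<close> and \<open>L y = g\<close> in \<open>L2\<close>. A function \<open>y\<close> occurring in the graph of a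
  differential operator is the absolutely continuous representative of its class.
\<close>

type_synonym 's L2_op = "((real \<Rightarrow> complex^'s) \<times> (real \<Rightarrow> complex^'s)) set"

definition L_max ::
    "real \<Rightarrow> real \<Rightarrow> (real \<Rightarrow> complex^'s^'s) \<Rightarrow> (real \<Rightarrow> complex^'s^'s) \<Rightarrow> 's::finite L2_op" where
  "L_max a b p Q =
     {(y, g). y \<in> L2 a b \<and> g \<in> L2 a b \<and> absolutely_continuous_fun a b y \<and>
        (\<exists>u. quasi_deriv1 a b p Q y u \<and> quasi_deriv2 a b p Q y u (\<lambda>t. - g t))}"

definition L_bdry ::
    "real \<Rightarrow> real \<Rightarrow> (real \<Rightarrow> complex^'s^'s) \<Rightarrow> (real \<Rightarrow> complex^'s^'s)
      \<Rightarrow> complex^('s + 's)^('s + 's) \<Rightarrow> complex^('s + 's)^('s + 's) \<Rightarrow> 's::finite L2_op" where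
  "L_bdry a b p Q \<alpha> \<beta> =
     {(y, g). (y, g) \<in> L_max a b p Q \<and>
        (\<exists>u. quasi_deriv1 a b p Q y u \<and> \<alpha> *v bdry_vec y u a + \<beta> *v bdry_vec y u b = 0)}"

text \<open>
  \<open>\<mu>\<close> is in the resolvent set if \<open>L - \<mu>\<close> is a bijection from its domain onto \<open>L2\<close> with
  bounded inverse.
\<close>

definition resolvent_set :: "real \<Rightarrow> real \<Rightarrow> 's::finite L2_op \<Rightarrow> complex set" where
  "resolvent_set a b L =
     {\<mu>. (\<forall>f\<in>L2 a b. \<exists>(y, g)\<in>L. AE t in leb a b. g t - \<mu> *s y t = f t) \<and>
         (\<forall>(y, g)\<in>L. \<forall>(z, h)\<in>L.
            (AE t in leb a b. g t - \<mu> *s y t = h t - \<mu> *s z t) \<longrightarrow> (AE t in leb a b. y t = z t)) \<and>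
         (\<exists>C. \<forall>(y, g)\<in>L. L2_norm a b y \<le> C * L2_norm a b (\<lambda>t. g t - \<mu> *s y t))}"

text \<open>For \<open>\<mu>\<close> in the resolvent set the value below is unique up to equality almost everywhere.\<close>

definition resolvent ::
    "real \<Rightarrow> real \<Rightarrow> 's::finite L2_op \<Rightarrow> complex \<Rightarrow> (real \<Rightarrow> complex^'s) \<Rightarrow> (real \<Rightarrow> complex^'s)" where
  "resolvent a b L \<mu> f = (SOME y. \<exists>g. (y, g) \<in> L \<and> (AE t in leb a b. g t - \<mu> *s y t = f t))"

definition norm_resolvent_converges :: "real \<Rightarrow> real \<Rightarrow> (real \<Rightarrow> 's::finite L2_op) \<Rightarrow> bool" where
  "norm_resolvent_converges a b L \<longleftrightarrow>
     (\<exists>\<mu>\<in>resolvent_set a b (L 0).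
        (\<forall>\<^sub>F \<epsilon> in at_right 0. \<mu> \<in> resolvent_set a b (L \<epsilon>)) \<and>
        ((\<lambda>\<epsilon>. L2_onorm a b (\<lambda>f t. resolvent a b (L \<epsilon>) \<mu> f t - resolvent a b (L 0) \<mu> f t))
           \<longlongrightarrow> 0) (at_right 0))"

end

theory Submission
  imports Defs
begin

text \<open>
  With \<open>u\<close> for the quasi-derivative \<open>p y' - Q y\<close>, the equation \<open>l y - \<mu> y = f\<close> is the first-order
  system \<open>Y' = A Y + (0, -f)\<close> for \<open>Y = (y, u)\<close>, where the blocks of \<open>A\<close> are \<open>p\<^sup>-\<^sup>1 Q\<close>, \<open>p\<^sup>-\<^sup>1\<close>,
  \<open>-Q p\<^sup>-\<^sup>1 Q - \<mu>\<close> and \<open>-Q p\<^sup>-\<^sup>1\<close>. The convergence hypotheses say that the coefficients of the system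
  converge in \<open>L\<^sub>1\<close> and that the matrices in the boundary condition converge.

  For such systems, everything follows from a Gronwall estimate: an initial value problem has exactly
  one solution, this solution is bounded by its initial value and the \<open>L\<^sub>1\<close> norm of the right-hand
  side, and it depends continuously on the coefficients in \<open>L\<^sub>1\<close>, uniformly for bounded data. Let \<open>S c\<close> be
  the homogeneous solution with initial value \<open>c\<close>. The boundary value problem is uniquely solvable
  iff the linear map \<open>c \<mapsto> \<alpha> c + \<beta> (S c b)\<close> of a finite-dimensional space is injective. Injectivity
  of a linear map is stable in the quantitative form of a lower bound \<open>m * norm c\<close>. Hence unique
  solvability carries over to nearby problems, and their solutions with the same right-hand side \<open>F\<close>
  differ from the original one by at most \<open>e\<close> times the \<open>L\<^sub>1\<close> norm of \<open>F\<close>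
  (lemma \<open>bvp_stability\<close>). If \<open>\<mu>\<close> is in the resolvent set of the limit operator, its
  boundary value problem is injective (\<open>resolvent_set_imp_bvp_injective\<close>), so this applies. On a
  bounded interval the \<open>L\<^sub>1\<close> norm is dominated by the \<open>L\<^sub>2\<close> norm, and the uniform closeness of the
  solutions becomes convergence of the resolvents in the operator norm.

  The translation between the operator graphs, which speak of derivatives almost everywhere, and the
  integral form of the system rests on two facts about the Lebesgue integral on the line: indefinite
  integrals are differentiable almost everywhere (\<open>Lebesgue_differentiation\<close>), and absolutely
  continuous functions are the integrals of their derivatives (\<open>FTC_absolutely_continuous_fun\<close>).
\<close>

section \<open>Differentiation of indefinite integrals\<close>

lemma integral_diff_interval:
  fixes f :: "real \<Rightarrow> 'v::euclidean_space"
  assumes "f integrable_on {a..b}" "a \<le> s" "s \<le> t" "t \<le> b"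
  shows "integral {s..t} f = integral {a..t} f - integral {a..s} f"
proof -
  have "f integrable_on {a..t}" using assms by (meson integrable_subinterval_real atLeastatMost_subset_iff order_refl)
  from Henstock_Kurzweil_Integration.integral_combine[OF assms(2,3) this]
  show ?thesis by (simp add: algebra_simps)
qed

text \<open>
  Let a point be bad if the difference quotients of the integral stay away from \<open>f x\<close> by more than
  \<open>1 / (n + 1)\<close> on arbitrarily short intervals ending at \<open>x\<close>. Such intervals form a Vitali cover of
  the set of bad points. By Henstock's lemma the total length of disjoint fine intervals of this
  kind is arbitrarily small.
\<close>

lemma Lebesgue_differentiation:
  fixes f :: "real \<Rightarrow> 'v::euclidean_space"
  assumes f: "f integrable_on {a..b}"
  shows "negligible {x\<in>{a<..<b}. \<not> ((\<lambda>t. integral {a..t} f) has_vector_derivative f x) (at x)}"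
proof -
  define G where "G t = integral {a..t} f" for t
  define bad where "bad n x y \<longleftrightarrow> y \<in> {a<..<b} \<and> y \<noteq> x \<and>
      norm (G y - G x - (y - x) *\<^sub>R f x) > \<bar>y - x\<bar> / real (Suc n)" for n x y
  define E where "E n = {x\<in>{a<..<b}. \<forall>d>0. \<exists>y. \<bar>y - x\<bar> < d \<and> bad n x y}" for n
  have neg: "negligible (E n)" for n
    unfolding negligible_outer_le
  proof (intro allI impI)
    fix e :: real assume "e > 0"
    define e' where "e' = e / real (Suc n)"
    have "e' > 0" using \<open>e > 0\<close> by (simp add: e'_def)
    obtain \<gamma> where \<gamma>: "gauge \<gamma>"
      and H: "\<And>p. \<lbrakk>p tagged_partial_division_of cbox a b; \<gamma> fine p\<rbrakk> \<Longrightarrow>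
             (\<Sum>(x,k)\<in>p. norm(measure lborel k *\<^sub>R f x - integral k f)) < e'"
      using Henstock_lemma[of f a b e'] f \<open>e' > 0\<close> by auto
    \<comment> \<open>The pair \<open>(x, y)\<close> encodes the closed interval with end points \<open>x\<close> and \<open>y\<close>, tagged by \<open>x\<close>.\<close>
    define cen where "cen = (\<lambda>(x::real,y). (x + y) / 2)"
    define rad where "rad = (\<lambda>(x::real,y). \<bar>y - x\<bar> / 2)"
    define B where "B i = cball (cen i) (rad i)" for i
    have B: "B (x,y) = {min x y..max x y}" for x y
    proof (rule set_eqI)
      fix z show "z \<in> B (x,y) \<longleftrightarrow> z \<in> {min x y..max x y}"
        unfolding B_def cen_def rad_def by (simp add: dist_real_def field_simps) arith
    qed
    define K where "K = {(x,y). x \<in> E n \<and> bad n x y \<and> B (x,y) \<subseteq> \<gamma> x}"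
    have pos: "0 < rad i" if "i \<in> K" for i
      using that by (auto simp: K_def rad_def bad_def)
    have fine: "\<exists>i. i \<in> K \<and> x \<in> cball (cen i) (rad i) \<and> rad i < d" if x: "x \<in> E n" and d: "0 < d" for x d
    proof -
      obtain r where r: "r > 0" "ball x r \<subseteq> \<gamma> x"
        using \<gamma> by (meson gauge_def openE)
      obtain y where y: "\<bar>y - x\<bar> < min r d" "bad n x y"
        using x r d unfolding E_def by (smt (verit) mem_Collect_eq)
      have "B (x,y) \<subseteq> ball x r"
        using y by (auto simp: B ball_def dist_real_def)
      then have "(x,y) \<in> K" using x y r by (auto simp: K_def)
      moreover have "x \<in> B (x,y)" by (auto simp: B)
      moreover have "rad (x,y) < d" using y by (auto simp: rad_def)
      ultimately show ?thesis unfolding B_def by blast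
    qed
    obtain C where C: "countable C" "C \<subseteq> K"
       and disj: "pairwise (\<lambda>i j. disjnt (B i) (B j)) C"
       and neg: "negligible (E n - (\<Union>i\<in>C. B i))"
      using Vitali_covering_theorem_cballs[of K rad "E n" cen, OF pos fine] unfolding B_def by blast
    have meas: "B i \<in> lmeasurable" for i by (simp add: B_def)
    have fin: "measure lebesgue (\<Union>i\<in>I. B i) \<le> e" if I: "I \<subseteq> C" "finite I" for I
    proof -
      define p where "p = (\<lambda>i. (fst i, B i)) ` I"
      have IK: "i \<in> K" if "i \<in> I" for i using that I C by blast
      have inj: "inj_on (\<lambda>i. (fst i, B i)) I"
      proof (rule inj_onI)
        fix i j assume ij: "i \<in> I" "j \<in> I" "(fst i, B i) = (fst j, B j)"
        have "B i \<noteq> {}" by (cases i) (auto simp: B)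
        then show "i = j" using ij disj I unfolding pairwise_def disjnt_def by (metis Int_absorb prod.inject subsetD)
      qed
      have tag: "p tagged_partial_division_of cbox a b"
        unfolding tagged_partial_division_of_def
      proof (intro conjI allI impI)
        show "finite p" using I by (simp add: p_def)
      next
        fix x k assume "(x, k) \<in> p"
        then obtain y where y: "(x,y) \<in> I" "k = B (x,y)" by (auto simp: p_def)
        show "x \<in> k" "\<exists>a b. k = cbox a b" using y by (auto simp: B)
        from IK[OF y(1)] have "x \<in> {a<..<b}" "y \<in> {a<..<b}" by (auto simp: K_def E_def bad_def)
        then show "k \<subseteq> cbox a b" using y by (auto simp: B)
      next
        fix x1 K1 x2 K2 assume *: "(x1, K1) \<in> p \<and> (x2, K2) \<in> p \<and> (x1, K1) \<noteq> (x2, K2)"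
        then obtain i j where ij: "i \<in> I" "j \<in> I" "K1 = B i" "K2 = B j" "i \<noteq> j"
          by (auto simp: p_def)
        then have "K1 \<inter> K2 = {}" using disj I unfolding pairwise_def disjnt_def by blast
        then show "interior K1 \<inter> interior K2 = {}" using interior_subset by blast
      qed
      have fp: "\<gamma> fine p"
      proof (rule fineI)
        fix x k assume "(x, k) \<in> p"
        then obtain y where y: "(x,y) \<in> I" "k = B (x,y)" by (auto simp: p_def)
        then show "k \<subseteq> \<gamma> x" using IK[OF y(1)] by (auto simp: K_def)
      qed
      have one: "measure lebesgue (B i) \<le> real (Suc n) * norm (measure lborel (B i) *\<^sub>R f (fst i) - integral (B i) f)" if "i \<in> I" for i
      proof -
        obtain x y where i: "i = (x,y)" by (cases i)
        have K: "x \<in> {a<..<b}" "bad n x y" using IK[OF that] by (auto simp: K_def i E_def)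
        then have y: "y \<in> {a<..<b}" "y \<noteq> x" and
           big: "norm (G y - G x - (y - x) *\<^sub>R f x) > \<bar>y - x\<bar> / real (Suc n)" by (auto simp: bad_def)
        have c: "measure lebesgue (B i) = \<bar>y - x\<bar>" by (auto simp: i B min_def max_def)
        have c': "measure lborel (B i) = \<bar>y - x\<bar>" by (auto simp: i B min_def max_def)
        have "norm (measure lborel (B i) *\<^sub>R f (fst i) - integral (B i) f) = norm (G y - G x - (y - x) *\<^sub>R f x)"
        proof (cases "x < y")
          case True
          then have "integral (B i) f = G y - G x"
            unfolding i B G_def using K y integral_diff_interval[OF f, of x y] by simp
          then show ?thesis using True unfolding c' by (simp add: i norm_minus_commute)
        next
          case False
          then have "integral (B i) f = G x - G y"
            unfolding i B G_def using K y integral_diff_interval[OF f, of y x] by simp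
          then have "measure lborel (B i) *\<^sub>R f (fst i) - integral (B i) f = G y - G x - (y - x) *\<^sub>R f x"
            using False unfolding c' by (simp add: i scaleR_diff_left)
          then show ?thesis by simp
        qed
        then show ?thesis using big unfolding c by (simp add: field_simps)
      qed
      have "measure lebesgue (\<Union>i\<in>I. B i) \<le> (\<Sum>i\<in>I. measure lebesgue (B i))"
        by (intro measure_UNION_le I(2)) (use meas in auto)
      also have "\<dots> \<le> (\<Sum>i\<in>I. real (Suc n) * norm (measure lborel (B i) *\<^sub>R f (fst i) - integral (B i) f))"
        by (intro sum_mono one)
      also have "\<dots> = real (Suc n) * (\<Sum>(x,k)\<in>p. norm(measure lborel k *\<^sub>R f x - integral k f))"
        by (simp add: p_def sum.reindex[OF inj] sum_distrib_left)
      also have "\<dots> \<le> real (Suc n) * e'"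
        using H[OF tag fp] by (intro mult_left_mono) auto
      also have "\<dots> = e" by (simp add: e'_def)
      finally show ?thesis .
    qed
    define U where "U = (\<Union>i\<in>C. B i)"
    have U: "U \<in> lmeasurable" "measure lebesgue U \<le> e"
      unfolding U_def
      using fmeasurable_UN_bound[OF C(1) meas fin] measure_UN_bound[OF C(1) meas fin] by auto
    show "\<exists>T. E n \<subseteq> T \<and> T \<in> lmeasurable \<and> measure lebesgue T \<le> e"
    proof (intro exI[of _ "U \<union> (E n - U)"] conjI)
      have N: "negligible (E n - U)" using neg by (simp add: U_def)
      show "U \<union> (E n - U) \<in> lmeasurable"
        by (rule fmeasurable.Un[OF U(1) negligible_imp_measurable[OF N]])
      have "measure lebesgue (U \<union> (E n - U)) \<le> measure lebesgue U + measure lebesgue (E n - U)"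
        using U N by (intro measure_Un_le) (auto simp: negligible_imp_sets)
      then show "measure lebesgue (U \<union> (E n - U)) \<le> e"
        using U negligible_imp_measure0[OF N] by simp
    qed auto
  qed
  have "{x\<in>{a<..<b}. \<not> (G has_vector_derivative f x) (at x)} \<subseteq> (\<Union>n. E n)"
  proof
    fix x assume "x \<in> {x\<in>{a<..<b}. \<not> (G has_vector_derivative f x) (at x)}"
    then have x: "x \<in> {a<..<b}" and nd: "\<not> (G has_vector_derivative f x) (at x)" by auto
    from nd obtain e where e: "e > 0" and
      nd: "\<And>d. d > 0 \<Longrightarrow> \<exists>y. norm (y - x) < d \<and> \<not> norm (G y - G x - (y - x) *\<^sub>R f x) \<le> e * norm (y - x)"
      unfolding has_vector_derivative_def has_derivative_within_alt
      by (auto simp: bounded_linear_scaleR_left)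
    obtain n where n: "1 / real (Suc n) < e" using e by (meson nat_approx_posE)
    have "x \<in> E n" unfolding E_def
    proof (safe intro!: x)
      fix d :: real assume "d > 0"
      then have "min d (min (x - a) (b - x)) > 0" using x by auto
      from nd[OF this] obtain y where y: "\<bar>y - x\<bar> < min d (min (x - a) (b - x))"
        and g: "norm (G y - G x - (y - x) *\<^sub>R f x) > e * \<bar>y - x\<bar>" by auto
      have "\<bar>y - x\<bar> / real (Suc n) \<le> e * \<bar>y - x\<bar>"
        using mult_right_mono[of "1 / real (Suc n)" e "\<bar>y - x\<bar>"] n by simp
      then show "\<exists>y. \<bar>y - x\<bar> < d \<and> bad n x y"
        using y g by (intro exI[of _ y]) (auto simp: bad_def)
    qed
    then show "x \<in> (\<Union>n. E n)" by blast
  qed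
  moreover have "negligible (\<Union>n. E n)" using neg by (rule negligible_Union_nat)
  ultimately show ?thesis unfolding G_def by (rule negligible_subset[rotated])
qed

section \<open>Absolutely continuous functions\<close>

lemma absolutely_continuous_funE:
  fixes f :: "real \<Rightarrow> 'v::euclidean_space"
  assumes "absolutely_continuous_fun a b f" "e > 0"
  obtains d where "d > 0"
    "\<And>D. \<lbrakk>D division_of \<Union>D; \<Union>D \<subseteq> {a..b}; (\<Sum>K\<in>D. measure lborel K) < d\<rbrakk>
         \<Longrightarrow> (\<Sum>K\<in>D. norm (f (Sup K) - f (Inf K))) < e"
  using assms unfolding absolutely_continuous_fun_def by meson

lemma division_member_real:
  assumes "D division_of (S::real set)" "K \<in> D"
  obtains u v where "u \<le> v" "K = {u..v}" "Sup K = v" "Inf K = u"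
proof -
  obtain u v where "K = cbox u v" "K \<noteq> {}" using division_ofD[OF assms(1)] assms(2) by metis
  then show ?thesis using that[of u v] by (auto simp: cbox_interval)
qed

lemma sum_measure_division:
  assumes "D division_of (S::real set)"
  shows "(\<Sum>K\<in>D. measure lborel K) = integral S (\<lambda>x. 1)"
    and "(\<lambda>x. 1::real) integrable_on S"
proof -
  have K: "(\<lambda>x. 1::real) integrable_on K \<and> integral K (\<lambda>x. 1) = measure lborel K" if "K \<in> D" for K
  proof -
    from division_member_real[OF assms that] obtain u v where "u \<le> v" "K = {u..v}" by metis
    then show ?thesis by (simp add: integrable_const_ivl)
  qed
  show "(\<lambda>x. 1::real) integrable_on S" using K by (intro integrable_combine_division[OF assms]) auto
  show "(\<Sum>K\<in>D. measure lborel K) = integral S (\<lambda>x. 1)"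
    using K by (subst integral_combine_division_bottomup[OF assms]) auto
qed

lemma absolutely_continuous_fun_imp_continuous_on:
  fixes f :: "real \<Rightarrow> 'v::euclidean_space"
  assumes "absolutely_continuous_fun a b f"
  shows "continuous_on {a..b} f"
  unfolding continuous_on_iff
proof (intro ballI allI impI)
  fix x e :: real assume x: "x \<in> {a..b}" and e: "0 < e"
  from absolutely_continuous_funE[OF assms e] obtain d where d: "d > 0" and
    D: "\<And>D. \<lbrakk>D division_of \<Union>D; \<Union>D \<subseteq> {a..b}; (\<Sum>K\<in>D. measure lborel K) < d\<rbrakk>
         \<Longrightarrow> (\<Sum>K\<in>D. norm (f (Sup K) - f (Inf K))) < e" by metis
  have *: "norm (f v - f u) < e" if "u \<le> v" "v - u < d" "{u..v} \<subseteq> {a..b}" for u v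
  proof -
    have "{{u..v}} division_of {u..v}" using that(1) by (metis box_real(2) atLeastatMost_empty_iff2 division_of_self not_le)
    then show ?thesis using D[of "{{u..v}}"] that by simp
  qed
  have "dist (f x') (f x) < e" if "x' \<in> {a..b}" "dist x' x < d" for x'
    using *[of x x'] *[of x' x] that x by (cases "x \<le> x'") (auto simp: dist_norm norm_minus_commute)
  then show "\<exists>d>0. \<forall>x'\<in>{a..b}. dist x' x < d \<longrightarrow> dist (f x') (f x) < e" using d by blast
qed

text \<open>
  This covers components, compositions with Lipschitz functions, and functions that agree on
  \<open>{a..b}\<close> with an absolutely continuous one.
\<close>

lemma absolutely_continuous_fun_dominated:
  fixes f :: "real \<Rightarrow> 'v::euclidean_space" and g :: "real \<Rightarrow> 'w::euclidean_space"
  assumes f: "absolutely_continuous_fun a b f" and L: "0 \<le> L"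
    and le: "\<And>s t. \<lbrakk>a \<le> s; s \<le> t; t \<le> b\<rbrakk> \<Longrightarrow> norm (g t - g s) \<le> L * norm (f t - f s)"
  shows "absolutely_continuous_fun a b g"
  unfolding absolutely_continuous_fun_def
proof (intro allI impI)
  fix e :: real assume "e > 0"
  then have "e / (L + 1) > 0" using L by simp
  from absolutely_continuous_funE[OF f this] obtain d where d: "d > 0" and
    D: "\<And>D. \<lbrakk>D division_of \<Union>D; \<Union>D \<subseteq> {a..b}; (\<Sum>K\<in>D. measure lborel K) < d\<rbrakk>
         \<Longrightarrow> (\<Sum>K\<in>D. norm (f (Sup K) - f (Inf K))) < e / (L + 1)" by metis
  show "\<exists>d>0. \<forall>D. D division_of \<Union>D \<and> \<Union>D \<subseteq> {a..b} \<and> (\<Sum>K\<in>D. measure lborel K) < d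
            \<longrightarrow> (\<Sum>K\<in>D. norm (g (Sup K) - g (Inf K))) < e"
  proof (intro exI[of _ d] conjI d allI impI)
    fix D assume D': "D division_of \<Union>D \<and> \<Union>D \<subseteq> {a..b} \<and> (\<Sum>K\<in>D. measure lborel K) < d"
    have "(\<Sum>K\<in>D. norm (g (Sup K) - g (Inf K))) \<le> (\<Sum>K\<in>D. L * norm (f (Sup K) - f (Inf K)))"
    proof (rule sum_mono)
      fix K assume K: "K \<in> D"
      from D' have "D division_of \<Union>D" by simp
      from division_member_real[OF this K] obtain u v
        where uv: "u \<le> v" "K = {u..v}" "Sup K = v" "Inf K = u" by metis
      have "K \<subseteq> {a..b}" using K D' by blast
      then have "a \<le> u" "v \<le> b" using uv by auto
      then show "norm (g (Sup K) - g (Inf K)) \<le> L * norm (f (Sup K) - f (Inf K))"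
        using uv le by simp
    qed
    also have "\<dots> = L * (\<Sum>K\<in>D. norm (f (Sup K) - f (Inf K)))" by (simp add: sum_distrib_left)
    also have "\<dots> \<le> L * (e / (L + 1))" using D[of D] D' L by (intro mult_left_mono) auto
    also have "\<dots> < e" using \<open>e > 0\<close> L by (simp add: field_simps)
    finally show "(\<Sum>K\<in>D. norm (g (Sup K) - g (Inf K))) < e" .
  qed
qed

lemma absolutely_continuous_fun_integral:
  fixes f :: "real \<Rightarrow> 'v::euclidean_space"
  assumes f: "f absolutely_integrable_on {a..b}"
  shows "absolutely_continuous_fun a b (\<lambda>t. c + integral {a..t} f)"
  unfolding absolutely_continuous_fun_def
proof (intro allI impI)
  fix e :: real assume "e > 0"
  define g where "g x = norm (f x)" for x
  define h where "h n x = min (g x) (real n)" for n :: nat and x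
  have g: "g absolutely_integrable_on {a..b}" unfolding g_def
    using absolutely_integrable_norm[OF f] by (simp add: o_def)
  have h: "h n absolutely_integrable_on {a..b}" for n
    unfolding h_def using absolutely_integrable_min_1[OF g, of "\<lambda>_. real n"] by simp
  have gi: "g integrable_on {a..b}" and hi: "\<And>n. h n integrable_on {a..b}"
    using g h by (auto simp: absolutely_integrable_on_def)
  have lim: "(\<lambda>n. integral {a..b} (h n)) \<longlonglongrightarrow> integral {a..b} g"
  proof (rule dominated_convergence(2)[OF hi gi])
    show "norm (h n x) \<le> g x" for n x by (auto simp: h_def g_def)
    show "(\<lambda>n. h n x) \<longlonglongrightarrow> g x" for x
    proof (rule tendsto_eventually)
      obtain N where "g x \<le> real N" by (meson real_arch_simple)
      then show "\<forall>\<^sub>F n in sequentially. h n x = g x"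
        by (intro eventually_sequentiallyI[of N]) (auto simp: h_def)
    qed
  qed
  \<comment> \<open>Split \<open>norm f\<close> into a bounded part and a part with small integral.\<close>
  obtain N where N: "integral {a..b} g - integral {a..b} (h N) < e / 2"
    using LIMSEQ_D[OF lim, of "e/2"] \<open>e > 0\<close> by (smt (verit) half_gt_zero order_refl real_norm_def)
  define d where "d = e / (2 * (real N + 1))"
  have d: "d > 0" using \<open>e > 0\<close> by (simp add: d_def)
  show "\<exists>d>0. \<forall>D. D division_of \<Union>D \<and> \<Union>D \<subseteq> {a..b} \<and> (\<Sum>K\<in>D. measure lborel K) < d
            \<longrightarrow> (\<Sum>K\<in>D. norm ((c + integral {a..Sup K} f) - (c + integral {a..Inf K} f))) < e"
  proof (intro exI[of _ d] conjI d allI impI)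
    fix D assume D': "D division_of \<Union>D \<and> \<Union>D \<subseteq> {a..b} \<and> (\<Sum>K\<in>D. measure lborel K) < d"
    then have D: "D division_of \<Union>D" "\<Union>D \<subseteq> {a..b}" by auto
    have gU: "g integrable_on \<Union>D" and hU: "h N integrable_on \<Union>D"
      using integrable_on_subdivision[OF D(1)] gi hi D(2) by blast+
    have "(\<Sum>K\<in>D. norm ((c + integral {a..Sup K} f) - (c + integral {a..Inf K} f))) \<le> (\<Sum>K\<in>D. integral K g)"
    proof (rule sum_mono)
      fix K assume K: "K \<in> D"
      from division_member_real[OF D(1) this] obtain u v
        where uv: "u \<le> v" "K = {u..v}" "Sup K = v" "Inf K = u" by metis
      have "K \<subseteq> {a..b}" using K D by blast
      then have ab: "a \<le> u" "v \<le> b" using uv by auto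
      have "integral K f = integral {a..v} f - integral {a..u} f" unfolding uv(2)
        using uv ab f by (intro integral_diff_interval[of f a b]) (auto simp: absolutely_integrable_on_def)
      moreover have "norm (integral K f) \<le> integral K g" unfolding g_def uv(2)
        using absolutely_integrable_on_subinterval[OF f, of u v] ab
        by (intro integral_norm_bound_integral) (auto simp: absolutely_integrable_on_def)
      ultimately show "norm ((c + integral {a..Sup K} f) - (c + integral {a..Inf K} f)) \<le> integral K g"
        by (simp add: uv)
    qed
    also have "\<dots> = integral (\<Union>D) g"
      by (rule integral_combine_division_topdown[OF gU D(1), symmetric])
    also have "\<dots> = integral (\<Union>D) (\<lambda>x. g x - h N x) + integral (\<Union>D) (h N)"
      using gU hU by (simp add: integral_diff)
    also have "\<dots> \<le> e / 2 + real N * d"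
    proof (rule add_mono)
      have "integral (\<Union>D) (\<lambda>x. g x - h N x) \<le> integral {a..b} (\<lambda>x. g x - h N x)"
        by (intro integral_subset_le integrable_diff gU hU gi hi D) (simp add: h_def)
      also have "\<dots> < e / 2" using N gi hi by (simp add: integral_diff)
      finally show "integral (\<Union>D) (\<lambda>x. g x - h N x) \<le> e / 2" by simp
      have "integral (\<Union>D) (h N) \<le> integral (\<Union>D) (\<lambda>x. real N * 1)"
        using sum_measure_division(2)[OF D(1)] integrable_on_mult_right[OF sum_measure_division(2)[OF D(1)], of "real N"]
        by (intro integral_le hU) (auto simp: h_def)
      also have "\<dots> = real N * (\<Sum>K\<in>D. measure lborel K)"
        by (simp only: integral_mult_right sum_measure_division(1)[OF D(1)])
      also have "\<dots> \<le> real N * d" using D' by (intro mult_left_mono) auto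
      finally show "integral (\<Union>D) (h N) \<le> real N * d" .
    qed
    also have "\<dots> < e" using \<open>e > 0\<close> by (simp add: d_def field_simps)
    finally show "(\<Sum>K\<in>D. norm ((c + integral {a..Sup K} f) - (c + integral {a..Inf K} f))) < e" .
  qed
qed

text \<open>
  The proof exhibits a gauge. At points outside the exceptional set, the gauge comes from
  differentiability. The exceptional points are enclosed in an open set of small measure, and there
  the increments of \<open>F\<close> are controlled by absolute continuity. No integrability of \<open>h\<close> is needed
  beforehand.
\<close>

lemma FTC_absolutely_continuous_fun:
  fixes F :: "real \<Rightarrow> 'v::euclidean_space"
  assumes F: "absolutely_continuous_fun a b F" and ab: "a \<le> b" and N: "negligible N"
    and der: "\<And>x. x \<in> {a<..<b} - N \<Longrightarrow> (F has_vector_derivative h x) (at x)"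
  shows "(h has_integral (F b - F a)) {a..b}"
proof -
  \<comment> \<open>Nothing is known about the derivative of \<open>F\<close> at the end points.\<close>
  define N' where "N' = N \<union> {a,b}"
  have N': "negligible N'" using N by (simp add: N'_def)
  \<comment> \<open>A negligible set does not affect the integral, so the integrand may be taken to vanish there.\<close>
  define h' where "h' x = (if x \<in> N' then 0 else h x)" for x
  have "(h' has_integral (F b - F a)) {a..b}"
    unfolding has_integral_real
  proof (intro allI impI)
    fix e :: real assume "e > 0"
    define e2 where "e2 = e / (2 * (b - a + 1))"
    have e2: "e2 > 0" using ab \<open>e > 0\<close> by (simp add: e2_def)
    obtain d where d: "d > 0" and
      D: "\<And>D. \<lbrakk>D division_of \<Union>D; \<Union>D \<subseteq> {a..b}; (\<Sum>K\<in>D. measure lborel K) < d\<rbrakk>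
         \<Longrightarrow> (\<Sum>K\<in>D. norm (F (Sup K) - F (Inf K))) < e/2"
      by (rule absolutely_continuous_funE[OF F half_gt_zero[OF \<open>e > 0\<close>]]) (rule that)
    obtain U where U: "open U" "N' \<subseteq> U" "U \<in> lmeasurable" "measure lebesgue U < d"
    proof -
      obtain U where U: "open U" "N' \<subseteq> U" "U - N' \<in> lmeasurable" "emeasure lebesgue (U - N') < ennreal d"
        using sets_lebesgue_outer_open[OF negligible_imp_sets[OF N'] d] by metis
      have "U = (U - N') \<union> N'" using U(2) by blast
      moreover have "measure lebesgue ((U - N') \<union> N') = measure lebesgue (U - N')"
        by (rule measure_Un_null_set) (use N' U(3) in \<open>auto simp: negligible_iff_null_sets\<close>)
      moreover have "(U - N') \<union> N' \<in> lmeasurable"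
        by (rule fmeasurable.Un[OF U(3) negligible_imp_measurable[OF N']])
      moreover have "measure lebesgue (U - N') < d"
        using U(3,4) d by (simp add: emeasure_eq_measure2 ennreal_less_iff)
      ultimately show ?thesis using that[of U] U(1,2) by simp
    qed
    have "\<exists>r>0. \<forall>y. \<bar>y - x\<bar> < r \<longrightarrow> norm (F y - F x - (y - x) *\<^sub>R h x) \<le> e2 * \<bar>y - x\<bar>"
      if "x \<in> {a<..<b} - N'" for x
      using der[of x] that e2
      unfolding has_vector_derivative_def has_derivative_within_alt N'_def by auto
    then obtain r where r: "\<And>x. x \<in> {a<..<b} - N' \<Longrightarrow> r x > 0"
      "\<And>x y. \<lbrakk>x \<in> {a<..<b} - N'; \<bar>y - x\<bar> < r x\<rbrakk> \<Longrightarrow> norm (F y - F x - (y - x) *\<^sub>R h x) \<le> e2 * \<bar>y - x\<bar>"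
      by metis
    define \<gamma> where "\<gamma> x = (if x \<in> N' then U else if x \<in> {a<..<b} then ball x (r x) else ball x 1)" for x
    have \<gamma>: "gauge \<gamma>" unfolding gauge_def
      using U r(1) by (auto simp: \<gamma>_def)
    show "\<exists>\<gamma>. gauge \<gamma> \<and> (\<forall>\<D>. \<D> tagged_division_of {a..b} \<and> \<gamma> fine \<D> \<longrightarrow>
             norm ((\<Sum>(x, k)\<in>\<D>. measure lborel k *\<^sub>R h' x) - (F b - F a)) < e)"
    proof (intro exI[of _ \<gamma>] conjI \<gamma> allI impI)
      fix p assume p': "p tagged_division_of {a..b} \<and> \<gamma> fine p"
      then have p: "p tagged_division_of {a..b}" and fine: "\<gamma> fine p" by auto
      have fp: "finite p" using p by blast
      define T where "T = (\<lambda>(x,K). measure lborel K *\<^sub>R h' x - (F (Sup K) - F (Inf K)))"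
      define p1 where "p1 = {xK\<in>p. fst xK \<in> N'}"
      have mem: "\<exists>u v. u \<le> v \<and> K = {u..v} \<and> Sup K = v \<and> Inf K = u \<and> x \<in> K \<and> K \<subseteq> {a..b} \<and> K \<subseteq> \<gamma> x"
        if "(x,K) \<in> p" for x K
      proof -
        have "K \<in> snd ` p" using that by force
        from division_member_real[OF division_of_tagged_division[OF p] this]
        obtain u v where "u \<le> v" "K = {u..v}" "Sup K = v" "Inf K = u" by metis
        then show ?thesis using tagged_division_ofD(2,3)[OF p that] fineD[OF fine that] by blast
      qed
      have "(\<Sum>(x, k)\<in>p. measure lborel k *\<^sub>R h' x) - (F b - F a) = (\<Sum>xK\<in>p. T xK)"
        unfolding additive_tagged_division_1[OF ab p, symmetric, of F] T_def
        by (simp add: sum_subtractf split_def)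
      also have "\<dots> = (\<Sum>xK\<in>p1. T xK) + (\<Sum>xK\<in>p - p1. T xK)"
        using fp by (subst sum.subset_diff[of p1 p]) (auto simp: p1_def)
      also have "norm \<dots> < e / 2 + e / 2"
      proof (rule norm_add_less)
        have p1: "p1 tagged_partial_division_of {a..b}"
          using p by (auto simp: p1_def tagged_division_of_def intro: tagged_partial_division_subset)
        have p1': "p1 tagged_division_of \<Union>(snd ` p1)"
          by (rule tagged_partial_division_of_Union_self[OF p1])
        have D1: "(snd ` p1) division_of \<Union>(snd ` p1)" by (rule division_of_tagged_division[OF p1'])
        have sub: "\<Union>(snd ` p1) \<subseteq> {a..b}" "\<Union>(snd ` p1) \<subseteq> U"
          using mem by (fastforce simp: p1_def \<gamma>_def)+
        have mU: "\<Union>(snd ` p1) \<in> lmeasurable"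
          by (rule lmeasurable_division[OF D1])
        have "(\<Sum>K\<in>snd ` p1. measure lborel K) = measure lebesgue (\<Union>(snd ` p1))"
          by (simp add: sum_measure_division(1)[OF D1] lmeasure_integral[OF mU])
        also have "\<dots> \<le> measure lebesgue U"
          using sub(2) U mU by (intro measure_mono_fmeasurable) auto
        finally have small: "(\<Sum>K\<in>snd ` p1. measure lborel K) < d" using U by linarith
        \<comment> \<open>The case distinction makes \<open>\<Delta>\<close> vanish on every interval with empty interior.\<close>
        define \<Delta> where "\<Delta> K = (if K = {} then 0 else norm (F (Sup K) - F (Inf K)))" for K
        have "norm (\<Sum>xK\<in>p1. T xK) \<le> (\<Sum>xK\<in>p1. norm (T xK))" by (rule norm_sum)
        also have "\<dots> = (\<Sum>(x,K)\<in>p1. \<Delta> K)"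
          using mem by (intro sum.cong refl) (fastforce simp: p1_def T_def h'_def \<Delta>_def norm_minus_commute)
        also have "\<dots> = (\<Sum>K\<in>snd ` p1. \<Delta> K)"
        proof (rule sum.over_tagged_division_lemma[OF p1'])
          fix u v :: real assume uv: "box u v = {}"
          show "\<Delta> (cbox u v) = 0"
            using uv by (cases "u = v") (auto simp: \<Delta>_def not_less)
        qed
        also have "\<dots> = (\<Sum>K\<in>snd ` p1. norm (F (Sup K) - F (Inf K)))"
          using mem by (intro sum.cong refl) (fastforce simp: p1_def \<Delta>_def)
        also have "\<dots> < e / 2" by (rule D[OF D1 sub(1) small])
        finally show "norm (\<Sum>xK\<in>p1. T xK) < e / 2" .
      next
        have "norm (\<Sum>xK\<in>p - p1. T xK) \<le> (\<Sum>xK\<in>p - p1. e2 * (case xK of (x,K) \<Rightarrow> Sup K - Inf K))"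
        proof (rule sum_norm_le)
          fix xK assume "xK \<in> p - p1"
          then obtain x K where xK: "xK = (x,K)" "(x,K) \<in> p" "x \<notin> N'" by (cases xK) (auto simp: p1_def)
          from mem[OF xK(2)] obtain u v where uv: "u \<le> v" "K = {u..v}" "Sup K = v" "Inf K = u" "x \<in> K" "K \<subseteq> {a..b}" "K \<subseteq> \<gamma> x"
            by blast
          have x: "x \<in> {a<..<b} - N'" using uv xK(3) by (auto simp: N'_def less_le)
          then have "K \<subseteq> ball x (r x)" using uv(7) by (simp add: \<gamma>_def)
          moreover have "u \<in> K" "v \<in> K" using uv(1,2) by auto
          ultimately have "u \<in> ball x (r x)" "v \<in> ball x (r x)" by blast+
          then have b: "\<bar>u - x\<bar> < r x" "\<bar>v - x\<bar> < r x" by (auto simp: dist_real_def)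
          have "T xK = (F u - F x - (u - x) *\<^sub>R h x) - (F v - F x - (v - x) *\<^sub>R h x)"
            using uv x xK by (simp add: T_def h'_def algebra_simps)
          also have "norm \<dots> \<le> e2 * \<bar>u - x\<bar> + e2 * \<bar>v - x\<bar>"
            using r(2)[OF x b(1)] r(2)[OF x b(2)] norm_triangle_ineq4 by (smt (verit))
          also have "\<dots> = e2 * (v - u)" using uv by (simp add: algebra_simps)
          finally show "norm (T xK) \<le> e2 * (case xK of (x,K) \<Rightarrow> Sup K - Inf K)" by (simp add: xK uv)
        qed
        also have "\<dots> \<le> (\<Sum>xK\<in>p. e2 * (case xK of (x,K) \<Rightarrow> Sup K - Inf K))"
          using fp e2 mem by (intro sum_mono2) (fastforce intro!: mult_nonneg_nonneg)+
        also have "\<dots> = e2 * (b - a)"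
          using additive_tagged_division_1[OF ab p, of "\<lambda>x. x"] by (simp add: sum_distrib_left[symmetric])
        also have "\<dots> < e / 2" using ab \<open>e > 0\<close> by (simp add: e2_def field_simps)
        finally show "norm (\<Sum>xK\<in>p - p1. T xK) < e / 2" .
      qed
      finally show "norm ((\<Sum>(x, k)\<in>p. measure lborel k *\<^sub>R h' x) - (F b - F a)) < e" by simp
    qed
  qed
  then show ?thesis
    by (rule has_integral_spike[OF N', rotated]) (simp add: h'_def)
qed

section \<open>Linear systems with integrable coefficients\<close>

text \<open>
  A linear system \<open>Y' = A t Y\<close> on \<open>{a..b}\<close>. The coefficients are real-linear maps of a Euclidean
  space, measurable in \<open>t\<close>, and their operator norms are bounded by an integrable function \<open>k\<close>.
\<close>

definition integrable_system ::
    "real \<Rightarrow> real \<Rightarrow> (real \<Rightarrow> 'v::euclidean_space \<Rightarrow> 'v) \<Rightarrow> (real \<Rightarrow> real) \<Rightarrow> bool" where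
  "integrable_system a b A k \<longleftrightarrow> a \<le> b \<and> k integrable_on {a..b} \<and>
     (\<forall>t\<in>{a..b}. linear (A t) \<and> 0 \<le> k t \<and> (\<forall>v. norm (A t v) \<le> k t * norm v)) \<and>
     (\<forall>v. (\<lambda>t. A t v) \<in> borel_measurable (lebesgue_on {a..b}))"

text \<open>
  The solutions in the sense of Caratheodory of \<open>Y' = A t Y + F t\<close>, given by the integral equation.
\<close>

definition solves ::
    "real \<Rightarrow> real \<Rightarrow> (real \<Rightarrow> 'v::euclidean_space \<Rightarrow> 'v) \<Rightarrow> (real \<Rightarrow> 'v) \<Rightarrow> (real \<Rightarrow> 'v) \<Rightarrow> bool" where
  "solves a b A F Y \<longleftrightarrow> continuous_on {a..b} Y \<and>
     (\<forall>t\<in>{a..b}. Y t = Y a + integral {a..t} (\<lambda>s. A s (Y s) + F s))"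

lemma integrable_system_compose:
  assumes A: "integrable_system a b A k" and Y: "continuous_on {a..b} Y"
  shows "(\<lambda>s. A s (Y s)) absolutely_integrable_on {a..b}"
proof -
  obtain B where B: "\<And>s. s \<in> {a..b} \<Longrightarrow> norm (Y s) \<le> B"
    using compact_imp_bounded[OF compact_continuous_image[OF Y compact_Icc]]
    unfolding bounded_iff by blast
  have eq: "A s (Y s) = (\<Sum>i\<in>Basis. (Y s \<bullet> i) *\<^sub>R A s i)" if "s \<in> {a..b}" for s
  proof -
    have lin: "linear (A s)" using A that by (auto simp: integrable_system_def)
    have "A s (Y s) = A s (\<Sum>i\<in>Basis. (Y s \<bullet> i) *\<^sub>R i)" by (simp add: euclidean_representation)
    also have "\<dots> = (\<Sum>i\<in>Basis. (Y s \<bullet> i) *\<^sub>R A s i)"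
      using lin by (simp add: linear_sum linear_scale o_def)
    finally show ?thesis .
  qed
  have Ym: "Y \<in> borel_measurable (lebesgue_on {a..b})"
    by (rule continuous_imp_measurable_on_sets_lebesgue[OF Y]) simp
  have Am: "(\<lambda>s. A s i) \<in> borel_measurable (lebesgue_on {a..b})" for i
    using A by (auto simp: integrable_system_def)
  have "(\<lambda>s. \<Sum>i\<in>Basis. (Y s \<bullet> i) *\<^sub>R A s i) \<in> borel_measurable (lebesgue_on {a..b})"
    using Ym Am by (intro borel_measurable_sum borel_measurable_scaleR borel_measurable_inner) auto
  then have "(\<lambda>s. A s (Y s)) \<in> borel_measurable (lebesgue_on {a..b})"
    by (subst measurable_cong[where g="\<lambda>s. \<Sum>i\<in>Basis. (Y s \<bullet> i) *\<^sub>R A s i"]) (auto simp: eq)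
  moreover have "(\<lambda>s. k s * B) integrable_on {a..b}"
    using A by (intro integrable_on_mult_left) (auto simp: integrable_system_def)
  moreover have "norm (A s (Y s)) \<le> k s * B" if s: "s \<in> {a..b}" for s
  proof -
    have "norm (A s (Y s)) \<le> k s * norm (Y s)" "0 \<le> k s"
      using A s by (auto simp: integrable_system_def)
    with B[OF s] show ?thesis by (meson mult_left_mono order_trans)
  qed
  ultimately show ?thesis
    by (intro measurable_bounded_by_integrable_imp_absolutely_integrable) auto
qed

text \<open>
  The weight \<open>exp (2 * integral {a..t} k)\<close> grows so fast that integration against \<open>k\<close> gains the
  factor \<open>1/2\<close>. This gives both the Gronwall estimate and the contraction in the existence proof.
\<close>

lemma exp_weight_has_integral:
  fixes k :: "real \<Rightarrow> real"
  assumes k: "k integrable_on {a..b}" and nn: "\<And>s. s \<in> {a..b} \<Longrightarrow> 0 \<le> k s" and t: "t \<in> {a..b}"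
  shows "((\<lambda>s. k s * exp (2 * integral {a..s} k)) has_integral (exp (2 * integral {a..t} k) - 1) / 2) {a..t}"
proof -
  define m where "m s = integral {a..s} k" for s
  have kt: "k integrable_on {a..t}" using k t by (meson integrable_subinterval_real atLeastAtMost_iff atLeastatMost_subset_iff order_refl)
  have kat: "k absolutely_integrable_on {a..t}"
    using nn t by (intro nonnegative_absolutely_integrable_1[OF kt]) auto
  have mono: "m s \<le> m s'" if "a \<le> s" "s \<le> s'" "s' \<le> t" for s s'
  proof -
    have "m s' - m s = integral {s..s'} k" unfolding m_def
      using integral_diff_interval[OF kt that] by simp
    also have "\<dots> \<ge> 0"
      using that t nn by (intro integral_nonneg integrable_subinterval_real[OF kt]) auto
    finally show ?thesis by simp
  qed
  have "absolutely_continuous_fun a t (\<lambda>s. exp (2 * m s) / 2)"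
  proof (rule absolutely_continuous_fun_dominated)
    show "absolutely_continuous_fun a t m"
      using absolutely_continuous_fun_integral[OF kat, of 0] unfolding m_def[abs_def] by simp
    show "0 \<le> exp (2 * m t)" by simp
    fix s s' assume s: "a \<le> s" "s \<le> s'" "s' \<le> t"
    have "1 + (2 * m s - 2 * m s') \<le> exp (2 * m s - 2 * m s')" by (rule exp_ge_add_one_self)
    then have "exp (2 * m s') * (1 + (2 * m s - 2 * m s')) \<le> exp (2 * m s') * exp (2 * m s - 2 * m s')"
      by (rule mult_left_mono) simp
    then have "exp (2 * m s') - exp (2 * m s) \<le> exp (2 * m s') * (2 * (m s' - m s))"
      by (simp add: exp_add[symmetric] algebra_simps)
    also have "\<dots> \<le> exp (2 * m t) * (2 * (m s' - m s))"
      using mono s by (intro mult_right_mono) auto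
    finally show "norm (exp (2 * m s') / 2 - exp (2 * m s) / 2) \<le> exp (2 * m t) * norm (m s' - m s)"
      using mono[OF s] by (simp add: field_simps)
  qed
  then have "((\<lambda>s. k s * exp (2 * m s)) has_integral exp (2 * m t) / 2 - exp (2 * m a) / 2) {a..t}"
  proof (rule FTC_absolutely_continuous_fun[OF _ _ Lebesgue_differentiation[OF kt]])
    show "a \<le> t" using t by simp
    fix x assume "x \<in> {a<..<t} - {x \<in> {a<..<t}. \<not> ((\<lambda>t. integral {a..t} k) has_vector_derivative k x) (at x)}"
    then have "(m has_field_derivative k x) (at x)"
      unfolding m_def[abs_def] by (auto simp: has_real_derivative_iff_has_vector_derivative)
    then have "((\<lambda>s. exp (2 * m s) / 2) has_field_derivative k x * exp (2 * m x)) (at x)"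
      by (auto intro!: derivative_eq_intros)
    then show "((\<lambda>s. exp (2 * m s) / 2) has_vector_derivative k x * exp (2 * m x)) (at x)"
      by (simp add: has_real_derivative_iff_has_vector_derivative)
  qed
  then show ?thesis by (simp add: m_def diff_divide_distrib)
qed

lemma Gronwall_integrable:
  fixes k v :: "real \<Rightarrow> real"
  assumes k: "k integrable_on {a..b}" and nn: "\<And>s. s \<in> {a..b} \<Longrightarrow> 0 \<le> k s"
    and v: "continuous_on {a..b} v" and v0: "\<And>s. s \<in> {a..b} \<Longrightarrow> 0 \<le> v s" and C: "0 \<le> C"
    and le: "\<And>t. t \<in> {a..b} \<Longrightarrow> v t \<le> C + integral {a..t} (\<lambda>s. k s * v s)"
    and t: "t \<in> {a..b}"
  shows "v t \<le> 2 * C * exp (2 * integral {a..b} k)"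
proof -
  define m where "m s = integral {a..s} k" for s
  have ab: "a \<le> b" using t by simp
  have kt: "k integrable_on {a..s}" if "s \<in> {a..b}" for s
    using k that by (meson integrable_subinterval_real atLeastAtMost_iff atLeastatMost_subset_iff order_refl)
  have m0: "0 \<le> m s" if "s \<in> {a..b}" for s
    unfolding m_def using that nn by (intro integral_nonneg kt) auto
  have mb: "m s \<le> m b" if "s \<in> {a..b}" for s
    unfolding m_def using that nn k by (intro integral_subset_le kt) auto
  have "continuous_on {a..b} (\<lambda>s. v s * exp (- 2 * m s))"
    unfolding m_def by (intro continuous_intros v indefinite_integral_continuous_1 k)
  moreover have "{a..b} \<noteq> {}" using t by blast
  ultimately obtain t0 where t0: "t0 \<in> {a..b}"
    and max: "\<And>s. s \<in> {a..b} \<Longrightarrow> v s * exp (- 2 * m s) \<le> v t0 * exp (- 2 * m t0)"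
    using continuous_attains_sup[OF compact_Icc, of a b "\<lambda>s. v s * exp (- 2 * m s)"] by blast
  \<comment> \<open>The estimate is absorbed at the point where the weighted function attains its maximum.\<close>
  define N where "N = v t0 * exp (- 2 * m t0)"
  have vN: "v s \<le> N * exp (2 * m s)" if "s \<in> {a..b}" for s
    using mult_right_mono[OF max[OF that], of "exp (2 * m s)"] by (simp add: N_def exp_minus field_simps)
  have N0: "0 \<le> N" using v0 t0 by (simp add: N_def)
  have kv: "(\<lambda>s. k s * v s) integrable_on {a..t0}"
  proof -
    have "(\<lambda>s. v s * k s) absolutely_integrable_on {a..b}"
    proof (rule absolutely_integrable_bounded_measurable_product_real)
      show "v \<in> borel_measurable (lebesgue_on {a..b})"
        by (rule continuous_imp_measurable_on_sets_lebesgue[OF v]) simp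
      show "bounded (v ` {a..b})" by (rule compact_imp_bounded[OF compact_continuous_image[OF v compact_Icc]])
      show "k absolutely_integrable_on {a..b}" using nn by (intro nonnegative_absolutely_integrable_1[OF k])
    qed auto
    then have "(\<lambda>s. k s * v s) integrable_on {a..b}" by (simp add: absolutely_integrable_on_def mult.commute)
    then show ?thesis by (rule integrable_subinterval_real) (use t0 in auto)
  qed
  have w: "((\<lambda>s. N * (k s * exp (2 * m s))) has_integral N * ((exp (2 * m t0) - 1) / 2)) {a..t0}"
    unfolding m_def by (intro has_integral_mult_right exp_weight_has_integral[OF k nn t0])
  have "v t0 \<le> C + integral {a..t0} (\<lambda>s. k s * v s)" by (rule le[OF t0])
  also have "integral {a..t0} (\<lambda>s. k s * v s) \<le> integral {a..t0} (\<lambda>s. N * (k s * exp (2 * m s)))"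
  proof (rule integral_le[OF kv])
    show "(\<lambda>s. N * (k s * exp (2 * m s))) integrable_on {a..t0}" using w by blast
    fix s assume "s \<in> {a..t0}"
    then have s: "s \<in> {a..b}" using t0 by auto
    show "k s * v s \<le> N * (k s * exp (2 * m s))"
      using mult_left_mono[OF vN[OF s] nn[OF s]] by (simp add: algebra_simps)
  qed
  also have "\<dots> = N * ((exp (2 * m t0) - 1) / 2)" using w by (rule integral_unique)
  finally have "v t0 \<le> C + N * ((exp (2 * m t0) - 1) / 2)" by simp
  then have "v t0 \<le> C + N * exp (2 * m t0) / 2" using N0 by (simp add: field_simps)
  then have "N \<le> (C + N * exp (2 * m t0) / 2) * exp (- 2 * m t0)"
    unfolding N_def by (intro mult_right_mono) auto
  also have "\<dots> = C * exp (- 2 * m t0) + N / 2" by (simp add: exp_minus field_simps)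
  also have "C * exp (- 2 * m t0) \<le> C" using C m0[OF t0] by (simp add: mult_left_le)
  finally have "N \<le> 2 * C" by simp
  have "v t \<le> N * exp (2 * m t)" by (rule vN[OF t])
  also have "\<dots> \<le> 2 * C * exp (2 * m b)"
    using \<open>N \<le> 2 * C\<close> C mb[OF t] by (intro mult_mono) auto
  finally show ?thesis by (simp add: m_def)
qed

lemma solves_bound:
  assumes A: "integrable_system a b A k" and F: "F absolutely_integrable_on {a..b}"
    and Y: "solves a b A F Y" and t: "t \<in> {a..b}"
  shows "norm (Y t) \<le> 2 * (norm (Y a) + integral {a..b} (\<lambda>s. norm (F s))) * exp (2 * integral {a..b} k)"
proof (rule Gronwall_integrable[where v="\<lambda>t. norm (Y t)", OF _ _ _ _ _ _ t])
  have cY: "continuous_on {a..b} Y" using Y by (simp add: solves_def)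
  have AY: "(\<lambda>s. A s (Y s)) absolutely_integrable_on {a..b}" by (rule integrable_system_compose[OF A cY])
  show k: "k integrable_on {a..b}" using A by (simp add: integrable_system_def)
  show nn: "0 \<le> k s" if "s \<in> {a..b}" for s using A that by (simp add: integrable_system_def)
  show "continuous_on {a..b} (\<lambda>t. norm (Y t))" using cY by (intro continuous_intros)
  show "0 \<le> norm (Y s)" for s by simp
  have nF: "(\<lambda>s. norm (F s)) integrable_on {a..b}" using F by (simp add: absolutely_integrable_on_def)
  then show "0 \<le> norm (Y a) + integral {a..b} (\<lambda>s. norm (F s))"
    by (intro add_nonneg_nonneg integral_nonneg) auto
  fix t assume t: "t \<in> {a..b}"
  have sub: "{a..t} \<subseteq> {a..b}" using t by auto
  have kY: "(\<lambda>s. k s * norm (Y s)) integrable_on {a..b}"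
  proof -
    have "(\<lambda>s. norm (Y s) * k s) absolutely_integrable_on {a..b}"
    proof (rule absolutely_integrable_bounded_measurable_product_real)
      have c: "continuous_on {a..b} (\<lambda>t. norm (Y t))" using cY by (intro continuous_intros)
      show "(\<lambda>t. norm (Y t)) \<in> borel_measurable (lebesgue_on {a..b})"
        by (rule continuous_imp_measurable_on_sets_lebesgue[OF c]) simp
      show "bounded ((\<lambda>t. norm (Y t)) ` {a..b})" by (rule compact_imp_bounded[OF compact_continuous_image[OF c compact_Icc]])
      show "k absolutely_integrable_on {a..b}" using nn by (intro nonnegative_absolutely_integrable_1[OF k])
    qed auto
    then show ?thesis by (simp add: absolutely_integrable_on_def mult.commute)
  qed
  have "norm (integral {a..t} (\<lambda>s. A s (Y s) + F s)) \<le> integral {a..t} (\<lambda>s. k s * norm (Y s) + norm (F s))"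
  proof (rule integral_norm_bound_integral)
    show "(\<lambda>s. A s (Y s) + F s) integrable_on {a..t}"
      using AY F sub by (intro integrable_add integrable_subinterval_real[OF _ sub]) (auto simp: absolutely_integrable_on_def)
    show "(\<lambda>s. k s * norm (Y s) + norm (F s)) integrable_on {a..t}"
      using kY nF by (intro integrable_add integrable_subinterval_real[OF _ sub])
    fix s assume "s \<in> {a..t}"
    then have "norm (A s (Y s)) \<le> k s * norm (Y s)" using A t by (auto simp: integrable_system_def)
    then show "norm (A s (Y s) + F s) \<le> k s * norm (Y s) + norm (F s)"
      using norm_triangle_ineq[of "A s (Y s)" "F s"] by linarith
  qed
  also have "\<dots> = integral {a..t} (\<lambda>s. k s * norm (Y s)) + integral {a..t} (\<lambda>s. norm (F s))"
    by (intro integral_add integrable_subinterval_real[OF _ sub] kY nF)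
  also have "integral {a..t} (\<lambda>s. norm (F s)) \<le> integral {a..b} (\<lambda>s. norm (F s))"
    by (intro integral_subset_le sub integrable_subinterval_real[OF _ sub] nF) auto
  moreover have "norm (Y t) \<le> norm (Y a) + norm (integral {a..t} (\<lambda>s. A s (Y s) + F s))"
  proof -
    have "Y t = Y a + integral {a..t} (\<lambda>s. A s (Y s) + F s)" using Y t unfolding solves_def by blast
    then show ?thesis using norm_triangle_ineq by metis
  qed
  ultimately show "norm (Y t) \<le> norm (Y a) + integral {a..b} (\<lambda>s. norm (F s)) + integral {a..t} (\<lambda>s. k s * norm (Y s))"
    by linarith
qed

lemma solves_lincomb:
  assumes A: "integrable_system a b A k"
    and F: "F absolutely_integrable_on {a..b}" "solves a b A F Y"
    and G: "G absolutely_integrable_on {a..b}" "solves a b A G Z"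
  shows "solves a b A (\<lambda>s. c *\<^sub>R F s + d *\<^sub>R G s) (\<lambda>s. c *\<^sub>R Y s + d *\<^sub>R Z s)"
  unfolding solves_def
proof (intro conjI ballI)
  have cY: "continuous_on {a..b} Y" and cZ: "continuous_on {a..b} Z" using F G by (auto simp: solves_def)
  show "continuous_on {a..b} (\<lambda>s. c *\<^sub>R Y s + d *\<^sub>R Z s)" by (intro continuous_intros cY cZ)
  fix t assume t: "t \<in> {a..b}"
  have sub: "{a..t} \<subseteq> {a..b}" using t by auto
  have iY: "(\<lambda>s. A s (Y s) + F s) integrable_on {a..t}" and iZ: "(\<lambda>s. A s (Z s) + G s) integrable_on {a..t}"
    using integrable_system_compose[OF A cY] integrable_system_compose[OF A cZ] F(1) G(1)
    by (auto intro!: integrable_add integrable_subinterval_real[OF _ sub] simp: absolutely_integrable_on_def)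
  have "integral {a..t} (\<lambda>s. A s (c *\<^sub>R Y s + d *\<^sub>R Z s) + (c *\<^sub>R F s + d *\<^sub>R G s))
      = integral {a..t} (\<lambda>s. c *\<^sub>R (A s (Y s) + F s) + d *\<^sub>R (A s (Z s) + G s))"
  proof (rule integral_cong)
    fix s assume "s \<in> {a..t}"
    then have "linear (A s)" using A t by (auto simp: integrable_system_def)
    then show "A s (c *\<^sub>R Y s + d *\<^sub>R Z s) + (c *\<^sub>R F s + d *\<^sub>R G s) = c *\<^sub>R (A s (Y s) + F s) + d *\<^sub>R (A s (Z s) + G s)"
      by (simp add: linear_add linear_scale algebra_simps)
  qed
  also have "\<dots> = c *\<^sub>R integral {a..t} (\<lambda>s. A s (Y s) + F s) + d *\<^sub>R integral {a..t} (\<lambda>s. A s (Z s) + G s)"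
    using iY iZ by (simp add: integral_add integrable_cmul)
  finally have fin: "integral {a..t} (\<lambda>s. A s (c *\<^sub>R Y s + d *\<^sub>R Z s) + (c *\<^sub>R F s + d *\<^sub>R G s)) =
      c *\<^sub>R integral {a..t} (\<lambda>s. A s (Y s) + F s) + d *\<^sub>R integral {a..t} (\<lambda>s. A s (Z s) + G s)" .
  have "Y t = Y a + integral {a..t} (\<lambda>s. A s (Y s) + F s)" "Z t = Z a + integral {a..t} (\<lambda>s. A s (Z s) + G s)"
    using F(2) G(2) t unfolding solves_def by blast+
  then have eq: "c *\<^sub>R Y t + d *\<^sub>R Z t = c *\<^sub>R (Y a + integral {a..t} (\<lambda>s. A s (Y s) + F s)) +
      d *\<^sub>R (Z a + integral {a..t} (\<lambda>s. A s (Z s) + G s))" by simp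
  show "c *\<^sub>R Y t + d *\<^sub>R Z t = c *\<^sub>R Y a + d *\<^sub>R Z a +
      integral {a..t} (\<lambda>s. A s (c *\<^sub>R Y s + d *\<^sub>R Z s) + (c *\<^sub>R F s + d *\<^sub>R G s))"
    unfolding fin eq by (simp add: scaleR_add_right)
qed

lemma solves_perturb:
  assumes A: "integrable_system a b A k" and A': "integrable_system a b A' k'"
    and F: "F absolutely_integrable_on {a..b}"
    and Y: "solves a b A F Y" and Z: "solves a b A' F Z"
    and d: "d integrable_on {a..b}"
    and dA: "\<And>s v. s \<in> {a..b} \<Longrightarrow> norm (A' s v - A s v) \<le> d s * norm v"
    and d0: "\<And>s. s \<in> {a..b} \<Longrightarrow> 0 \<le> d s"
    and B: "\<And>s. s \<in> {a..b} \<Longrightarrow> norm (Y s) \<le> B" and t: "t \<in> {a..b}"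
  shows "norm (Z t - Y t) \<le> 2 * (norm (Z a - Y a) + B * integral {a..b} d) * exp (2 * integral {a..b} k')"
proof -
  \<comment> \<open>The difference \<open>Z - Y\<close> solves the system \<open>A'\<close> with right-hand side \<open>G\<close>.\<close>
  define G where "G s = A' s (Y s) - A s (Y s)" for s
  have cY: "continuous_on {a..b} Y" and cZ: "continuous_on {a..b} Z" using Y Z by (auto simp: solves_def)
  note AY = integrable_system_compose[OF A cY] and A'Y = integrable_system_compose[OF A' cY]
    and A'Z = integrable_system_compose[OF A' cZ]
  have G: "G absolutely_integrable_on {a..b}" unfolding G_def by (intro set_integral_diff AY A'Y)
  have "solves a b A' G (\<lambda>s. Z s - Y s)" unfolding solves_def
  proof (intro conjI ballI)
    show "continuous_on {a..b} (\<lambda>s. Z s - Y s)" by (intro continuous_intros cY cZ)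
    fix t assume t: "t \<in> {a..b}"
    have sub: "{a..t} \<subseteq> {a..b}" using t by auto
    have iY: "(\<lambda>s. A s (Y s) + F s) integrable_on {a..t}" and iZ: "(\<lambda>s. A' s (Z s) + F s) integrable_on {a..t}"
      using AY A'Z F by (auto intro!: integrable_add integrable_subinterval_real[OF _ sub] simp: absolutely_integrable_on_def)
    have "integral {a..t} (\<lambda>s. A' s (Z s - Y s) + G s)
        = integral {a..t} (\<lambda>s. (A' s (Z s) + F s) - (A s (Y s) + F s))"
    proof (rule integral_cong)
      fix s assume "s \<in> {a..t}"
      then have "linear (A' s)" using A' t by (auto simp: integrable_system_def)
      then show "A' s (Z s - Y s) + G s = (A' s (Z s) + F s) - (A s (Y s) + F s)"
        by (simp add: linear_diff G_def)
    qed
    also have "\<dots> = integral {a..t} (\<lambda>s. A' s (Z s) + F s) - integral {a..t} (\<lambda>s. A s (Y s) + F s)"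
      by (rule integral_diff[OF iZ iY])
    finally have fin: "integral {a..t} (\<lambda>s. A' s (Z s - Y s) + G s) =
       integral {a..t} (\<lambda>s. A' s (Z s) + F s) - integral {a..t} (\<lambda>s. A s (Y s) + F s)" .
    show "Z t - Y t = Z a - Y a + integral {a..t} (\<lambda>s. A' s (Z s - Y s) + G s)"
    proof -
      have "Y t = Y a + integral {a..t} (\<lambda>s. A s (Y s) + F s)" "Z t = Z a + integral {a..t} (\<lambda>s. A' s (Z s) + F s)"
        using Y Z t unfolding solves_def by blast+
      then have "Z t - Y t = (Z a + integral {a..t} (\<lambda>s. A' s (Z s) + F s)) - (Y a + integral {a..t} (\<lambda>s. A s (Y s) + F s))"
        by simp
      then show ?thesis unfolding fin by simp
    qed
  qed
  from solves_bound[OF A' G this t]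
  have "norm (Z t - Y t) \<le> 2 * (norm (Z a - Y a) + integral {a..b} (\<lambda>s. norm (G s))) * exp (2 * integral {a..b} k')" .
  also have "integral {a..b} (\<lambda>s. norm (G s)) \<le> integral {a..b} (\<lambda>s. B * d s)"
  proof (rule integral_le)
    show "(\<lambda>s. norm (G s)) integrable_on {a..b}" using G by (simp add: absolutely_integrable_on_def)
    show "(\<lambda>s. B * d s) integrable_on {a..b}" by (intro integrable_on_mult_right d)
    fix s assume s: "s \<in> {a..b}"
    have "norm (G s) \<le> d s * norm (Y s)" unfolding G_def by (rule dA[OF s])
    also have "\<dots> \<le> d s * B" by (intro mult_left_mono B d0 s)
    finally show "norm (G s) \<le> B * d s" by (simp add: mult.commute)
  qed
  also have "\<dots> = B * integral {a..b} d" by simp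
  finally show ?thesis by simp
qed

text \<open>
  Banach's fixed point theorem for \<open>Z = Y / E\<close> in the supremum norm, with the exponential weight \<open>E\<close>
  above. To work with bounded continuous functions on the whole line, the argument is clamped to
  \<open>{a..b}\<close> by \<open>cl\<close>.
\<close>

lemma solves_exists:
  assumes A: "integrable_system a b A k" and F: "F absolutely_integrable_on {a..b}"
  obtains Y where "solves a b A F Y" "Y a = c"
proof -
  define m where "m s = integral {a..s} k" for s
  define E where "E s = exp (2 * m s)" for s
  define cl where "cl t = max a (min b t)" for t :: real
  have ab: "a \<le> b" and k: "k integrable_on {a..b}" using A by (auto simp: integrable_system_def)
  have nn: "\<And>s. s \<in> {a..b} \<Longrightarrow> 0 \<le> k s" using A by (auto simp: integrable_system_def)
  have cl: "cl t \<in> {a..b}" for t using ab by (auto simp: cl_def)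
  have cl_id: "cl t = t" if "t \<in> {a..b}" for t using that by (auto simp: cl_def)
  have ccl: "continuous_on UNIV cl" unfolding cl_def by (intro continuous_intros)
  have E0: "E s > 0" for s by (simp add: E_def)
  have Ea: "E a = 1" by (simp add: E_def m_def)
  have cE: "continuous_on {a..b} E" unfolding E_def m_def
    by (intro continuous_intros indefinite_integral_continuous_1 k)
  have cEZ: "continuous_on {a..b} (\<lambda>s. E s *\<^sub>R apply_bcontfun Z s)" for Z :: "real \<Rightarrow>\<^sub>C 'a"
    by (intro continuous_intros cE) auto
  define I where "I Z t = (c + integral {a..t} (\<lambda>s. A s (E s *\<^sub>R apply_bcontfun Z s) + F s)) /\<^sub>R E t"
    for Z :: "real \<Rightarrow>\<^sub>C 'a" and t
  have int: "(\<lambda>s. A s (E s *\<^sub>R apply_bcontfun Z s) + F s) integrable_on {a..b}" for Z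
    using integrable_system_compose[OF A cEZ] F by (intro integrable_add) (auto simp: absolutely_integrable_on_def)
  have cI: "continuous_on {a..b} (I Z)" for Z unfolding I_def
    using E0 by (intro continuous_intros indefinite_integral_continuous_1 int cE) (metis less_irrefl)
  have "(\<lambda>t. I Z (cl t)) \<in> bcontfun" for Z
  proof -
    have c: "continuous_on UNIV (\<lambda>t. I Z (cl t))"
      by (rule continuous_on_compose2[OF cI ccl]) (use cl in auto)
    have "bounded (I Z ` {a..b})" by (rule compact_imp_bounded[OF compact_continuous_image[OF cI compact_Icc]])
    then obtain B where "\<And>s. s \<in> {a..b} \<Longrightarrow> norm (I Z s) \<le> B"
      unfolding bounded_iff by blast
    then show ?thesis using cl by (intro bcontfun_normI[OF c]) auto
  qed
  then have app: "apply_bcontfun (Bcontfun (\<lambda>t. I Z (cl t))) t = I Z (cl t)" for Z t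
    by (simp add: Bcontfun_inverse)
  have "\<exists>!Z. Bcontfun (\<lambda>t. I Z (cl t)) = Z"
  proof (rule banach_fix_type[of "1/2"])
    show "\<forall>Z W. dist (Bcontfun (\<lambda>t. I Z (cl t))) (Bcontfun (\<lambda>t. I W (cl t))) \<le> 1/2 * dist Z W"
    proof (intro allI dist_bound)
      fix Z W :: "real \<Rightarrow>\<^sub>C 'a" and t'
      define t where "t = cl t'"
      have t: "t \<in> {a..b}" unfolding t_def by (rule cl)
      have sub: "{a..t} \<subseteq> {a..b}" using t by auto
      have w: "((\<lambda>s. dist Z W * (k s * exp (2 * m s))) has_integral dist Z W * ((exp (2 * m t) - 1) / 2)) {a..t}"
        unfolding m_def by (intro has_integral_mult_right exp_weight_has_integral[OF k nn t])
      have iZ: "(\<lambda>s. A s (E s *\<^sub>R apply_bcontfun Z s) + F s) integrable_on {a..t}" for Z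
        by (rule integrable_subinterval_real[OF int sub])
      have "integral {a..t} (\<lambda>s. A s (E s *\<^sub>R apply_bcontfun Z s) + F s) - integral {a..t} (\<lambda>s. A s (E s *\<^sub>R apply_bcontfun W s) + F s)
          = integral {a..t} (\<lambda>s. (A s (E s *\<^sub>R apply_bcontfun Z s) + F s) - (A s (E s *\<^sub>R apply_bcontfun W s) + F s))"
        by (intro integral_diff[symmetric] iZ)
      also have "norm \<dots> \<le> integral {a..t} (\<lambda>s. dist Z W * (k s * exp (2 * m s)))"
      proof (rule integral_norm_bound_integral)
        show "(\<lambda>s. (A s (E s *\<^sub>R apply_bcontfun Z s) + F s) - (A s (E s *\<^sub>R apply_bcontfun W s) + F s)) integrable_on {a..t}"
          by (intro integrable_diff iZ)
        show "(\<lambda>s. dist Z W * (k s * exp (2 * m s))) integrable_on {a..t}" using w by blast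
        fix s assume "s \<in> {a..t}"
        then have s: "s \<in> {a..b}" using sub by blast
        have lin: "linear (A s)" and bd: "\<And>v. norm (A s v) \<le> k s * norm v" using A s by (auto simp: integrable_system_def)
        have "(A s (E s *\<^sub>R apply_bcontfun Z s) + F s) - (A s (E s *\<^sub>R apply_bcontfun W s) + F s)
            = A s (E s *\<^sub>R (apply_bcontfun Z s - apply_bcontfun W s))"
          by (simp add: linear_diff[OF lin] algebra_simps)
        also have "norm \<dots> \<le> k s * norm (E s *\<^sub>R (apply_bcontfun Z s - apply_bcontfun W s))" by (rule bd)
        also have "\<dots> = k s * (E s * dist (apply_bcontfun Z s) (apply_bcontfun W s))"
          using E0[of s] by (simp add: dist_norm)
        also have "\<dots> \<le> k s * (E s * dist Z W)"
          using E0[of s] by (intro mult_left_mono nn s dist_bounded) auto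
        finally show "norm ((A s (E s *\<^sub>R apply_bcontfun Z s) + F s) - (A s (E s *\<^sub>R apply_bcontfun W s) + F s))
            \<le> dist Z W * (k s * exp (2 * m s))" by (simp add: E_def algebra_simps)
      qed
      also have "\<dots> = dist Z W * ((E t - 1) / 2)" using w unfolding E_def by (rule integral_unique)
      also have "\<dots> \<le> dist Z W * (E t / 2)" by (intro mult_left_mono) auto
      finally have le: "norm (integral {a..t} (\<lambda>s. A s (E s *\<^sub>R apply_bcontfun Z s) + F s) - integral {a..t} (\<lambda>s. A s (E s *\<^sub>R apply_bcontfun W s) + F s))
          \<le> dist Z W * (E t / 2)" .
      have "dist (I Z t) (I W t) = norm ((integral {a..t} (\<lambda>s. A s (E s *\<^sub>R apply_bcontfun Z s) + F s) - integral {a..t} (\<lambda>s. A s (E s *\<^sub>R apply_bcontfun W s) + F s)) /\<^sub>R E t)"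
        unfolding dist_norm I_def by (simp only: scaleR_diff_right[symmetric] add_diff_cancel_left)
      also have "\<dots> \<le> dist Z W * (E t / 2) / E t"
        unfolding norm_scaleR divide_inverse using E0[of t] le
        by (subst mult.commute, intro mult_mono) auto
      also have "\<dots> = 1/2 * dist Z W" using E0[of t] by simp
      finally show "dist (apply_bcontfun (Bcontfun (\<lambda>t. I Z (cl t))) t') (apply_bcontfun (Bcontfun (\<lambda>t. I W (cl t))) t') \<le> 1/2 * dist Z W"
        by (simp add: app t_def)
    qed
  qed auto
  then obtain Z where Z: "Bcontfun (\<lambda>t. I Z (cl t)) = Z" by blast
  define Y where "Y s = E s *\<^sub>R apply_bcontfun Z s" for s
  have eq: "Y t = c + integral {a..t} (\<lambda>s. A s (Y s) + F s)" if t: "t \<in> {a..b}" for t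
  proof -
    have "apply_bcontfun Z t = I Z t" using app[of Z t] unfolding Z cl_id[OF t] .
    then show ?thesis using E0[of t] by (simp add: Y_def I_def)
  qed
  have "Y a = c" using eq[of a] ab by simp
  moreover have "continuous_on {a..b} Y" unfolding Y_def by (rule cEZ)
  ultimately have "solves a b A F Y" using eq unfolding solves_def by metis
  then show thesis using that \<open>Y a = c\<close> by blast
qed

section \<open>Stability of linear boundary value problems\<close>

text \<open>
  Solutions of the system that satisfy a two-point boundary condition. The condition uses maps \<open>\<alpha>\<close> and \<open>\<beta>\<close> of the state space into itself, so there are as
  many conditions as unknowns.
\<close>

definition bvp_solution ::
    "real \<Rightarrow> real \<Rightarrow> (real \<Rightarrow> 'v::euclidean_space \<Rightarrow> 'v) \<Rightarrow> ('v \<Rightarrow> 'v) \<Rightarrow> ('v \<Rightarrow> 'v) \<Rightarrow> (real \<Rightarrow> 'v) \<Rightarrow> (real \<Rightarrow> 'v) \<Rightarrow> bool" where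
  "bvp_solution a b A \<alpha> \<beta> F Y \<longleftrightarrow> solves a b A F Y \<and> \<alpha> (Y a) + \<beta> (Y b) = 0"

text \<open>
  The problem \<open>A'\<close>, \<open>\<alpha>'\<close>, \<open>\<beta>'\<close> is \<open>\<eta>\<close>-close to the problem \<open>A\<close>, \<open>\<alpha>\<close>, \<open>\<beta>\<close>: the coefficients differ by
  at most \<open>\<eta>\<close> in the \<open>L\<^sub>1\<close> norm, expressed by a majorant \<open>d\<close>, and the boundary maps by at most \<open>\<eta>\<close> in
  the operator norm.
\<close>

definition bvp_perturbation ::
    "real \<Rightarrow> real \<Rightarrow> (real \<Rightarrow> 'v::euclidean_space \<Rightarrow> 'v) \<Rightarrow> (real \<Rightarrow> real) \<Rightarrow> ('v \<Rightarrow> 'v) \<Rightarrow> ('v \<Rightarrow> 'v) \<Rightarrow> real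
      \<Rightarrow> (real \<Rightarrow> 'v \<Rightarrow> 'v) \<Rightarrow> ('v \<Rightarrow> 'v) \<Rightarrow> ('v \<Rightarrow> 'v) \<Rightarrow> bool" where
  "bvp_perturbation a b A k \<alpha> \<beta> \<eta> A' \<alpha>' \<beta>' \<longleftrightarrow>
     linear \<alpha>' \<and> linear \<beta>' \<and>
     (\<forall>v. norm (\<alpha>' v - \<alpha> v) \<le> \<eta> * norm v) \<and> (\<forall>v. norm (\<beta>' v - \<beta> v) \<le> \<eta> * norm v) \<and>
     (\<exists>d. d integrable_on {a..b} \<and> integral {a..b} d \<le> \<eta> \<and> integrable_system a b A' (\<lambda>t. k t + d t) \<and>
        (\<forall>t\<in>{a..b}. 0 \<le> d t \<and> (\<forall>v. norm (A' t v - A t v) \<le> d t * norm v)))"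

lemma bvp_perturbationE:
  assumes "bvp_perturbation a b A k \<alpha> \<beta> \<eta> A' \<alpha>' \<beta>'"
  obtains d where "d integrable_on {a..b}" "integral {a..b} d \<le> \<eta>" "integrable_system a b A' (\<lambda>t. k t + d t)"
    "\<And>t v. t \<in> {a..b} \<Longrightarrow> norm (A' t v - A t v) \<le> d t * norm v" "\<And>t. t \<in> {a..b} \<Longrightarrow> 0 \<le> d t"
proof -
  have "\<exists>d. d integrable_on {a..b} \<and> integral {a..b} d \<le> \<eta> \<and> integrable_system a b A' (\<lambda>t. k t + d t) \<and>
        (\<forall>t\<in>{a..b}. 0 \<le> d t \<and> (\<forall>v. norm (A' t v - A t v) \<le> d t * norm v))"
    using assms unfolding bvp_perturbation_def by (elim conjE)
  then obtain d where d: "d integrable_on {a..b} \<and> integral {a..b} d \<le> \<eta> \<and> integrable_system a b A' (\<lambda>t. k t + d t) \<and>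
        (\<forall>t\<in>{a..b}. 0 \<le> d t \<and> (\<forall>v. norm (A' t v - A t v) \<le> d t * norm v))" ..
  show ?thesis
    by (rule that[of d]) (use d in blast)+
qed

lemma absolutely_integrable_0: "(\<lambda>_. 0::'v::euclidean_space) absolutely_integrable_on {a..b::real}"
  by simp

lemma solves_diff:
  assumes "integrable_system a b A k" "F absolutely_integrable_on {a..b}"
    and "solves a b A F Y" "solves a b A F Z"
  shows "solves a b A (\<lambda>_. 0) (\<lambda>s. Y s - Z s)"
  using solves_lincomb[OF assms(1) assms(2,3) assms(2,4), of 1 "-1"] by simp

lemma solves_unique:
  assumes A: "integrable_system a b A k" and F: "F absolutely_integrable_on {a..b}"
    and YZ: "solves a b A F Y" "solves a b A F Z" and eq: "Y a = Z a" and t: "t \<in> {a..b}"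
  shows "Y t = Z t"
  using solves_bound[OF A absolutely_integrable_0 solves_diff[OF A F YZ] t] eq by simp

text \<open>
  \<open>S c\<close> is the homogeneous solution with initial value \<open>c\<close>. The map sending \<open>c\<close> to the boundary value
  of \<open>S c\<close> is linear because solutions are unique, and it is injective if the homogeneous boundary
  value problem has only the trivial solution.
\<close>

lemma boundary_map:
  assumes A: "integrable_system a b A k" and \<alpha>: "linear \<alpha>" and \<beta>: "linear \<beta>"
    and inj: "\<forall>Y. bvp_solution a b A \<alpha> \<beta> (\<lambda>_. 0) Y \<longrightarrow> Y a = 0"
  obtains S where "\<And>c. solves a b A (\<lambda>_. 0) (S c)" "\<And>c. S c a = c"
    "linear (\<lambda>c. \<alpha> c + \<beta> (S c b))" "inj (\<lambda>c. \<alpha> c + \<beta> (S c b))"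
proof -
  have "\<forall>c. \<exists>Y. solves a b A (\<lambda>_. 0) Y \<and> Y a = c"
    using solves_exists[OF A absolutely_integrable_0] by metis
  then obtain S where S: "\<And>c. solves a b A (\<lambda>_. 0) (S c)" "\<And>c. S c a = c" by metis
  have ab: "b \<in> {a..b}" using A by (simp add: integrable_system_def)
  have comb: "S (r *\<^sub>R c + q *\<^sub>R c') b = r *\<^sub>R S c b + q *\<^sub>R S c' b" for r q c c'
  proof (rule solves_unique[OF A absolutely_integrable_0 S(1) _ _ ab])
    show "solves a b A (\<lambda>_. 0) (\<lambda>s. r *\<^sub>R S c s + q *\<^sub>R S c' s)"
      using solves_lincomb[OF A absolutely_integrable_0 S(1)[of c] absolutely_integrable_0 S(1)[of c'], of r q] by simp
  qed (simp add: S(2))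
  have "S (c + c') b = S c b + S c' b" for c c' using comb[of 1 c 1 c'] by simp
  moreover have "S (r *\<^sub>R c) b = r *\<^sub>R S c b" for r c using comb[of r c 0 0] by simp
  ultimately have lin: "linear (\<lambda>c. \<alpha> c + \<beta> (S c b))"
    by (intro linearI)
      (simp_all add: linear_add[OF \<alpha>] linear_add[OF \<beta>] linear_scale[OF \<alpha>] linear_scale[OF \<beta>] algebra_simps)
  have "inj (\<lambda>c. \<alpha> c + \<beta> (S c b))" unfolding linear_injective_0[OF lin]
  proof (intro allI impI)
    fix c assume "\<alpha> c + \<beta> (S c b) = 0"
    then show "c = 0" using inj[rule_format, of "S c"] S by (simp add: bvp_solution_def)
  qed
  with S lin show ?thesis by (rule that)
qed

lemma boundary_map_bounded_below:
  assumes A: "integrable_system a b A k" and \<alpha>: "linear \<alpha>" and \<beta>: "linear \<beta>"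
    and inj: "\<forall>Y. bvp_solution a b A \<alpha> \<beta> (\<lambda>_. 0) Y \<longrightarrow> Y a = 0"
  obtains m where "m > 0"
    "\<And>Y. solves a b A (\<lambda>_. 0) Y \<Longrightarrow> m * norm (Y a) \<le> norm (\<alpha> (Y a) + \<beta> (Y b))"
proof -
  obtain S where S: "\<And>c. solves a b A (\<lambda>_. 0) (S c)" "\<And>c. S c a = c"
    and M: "linear (\<lambda>c. \<alpha> c + \<beta> (S c b))" "inj (\<lambda>c. \<alpha> c + \<beta> (S c b))"
    by (rule boundary_map[OF A \<alpha> \<beta> inj]) (rule that)
  obtain m where m: "m > 0" "\<And>c. m * norm c \<le> norm (\<alpha> c + \<beta> (S c b))"
    using linear_inj_bounded_below_pos[OF M] by blast
  have ab: "b \<in> {a..b}" using A by (simp add: integrable_system_def)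
  have "m * norm (Y a) \<le> norm (\<alpha> (Y a) + \<beta> (Y b))" if "solves a b A (\<lambda>_. 0) Y" for Y
  proof -
    have "S (Y a) b = Y b"
      by (rule solves_unique[OF A absolutely_integrable_0 S(1) that _ ab]) (simp add: S(2))
    then show ?thesis using m(2)[of "Y a"] by simp
  qed
  with m(1) show ?thesis by (rule that)
qed

lemma bvp_exists:
  assumes A: "integrable_system a b A k" and \<alpha>: "linear \<alpha>" and \<beta>: "linear \<beta>"
    and inj: "\<forall>Y. bvp_solution a b A \<alpha> \<beta> (\<lambda>_. 0) Y \<longrightarrow> Y a = 0"
    and F: "F absolutely_integrable_on {a..b}"
  obtains Y where "bvp_solution a b A \<alpha> \<beta> F Y"
proof -
  obtain S where S: "\<And>c. solves a b A (\<lambda>_. 0) (S c)" "\<And>c. S c a = c"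
    and M: "linear (\<lambda>c. \<alpha> c + \<beta> (S c b))" "inj (\<lambda>c. \<alpha> c + \<beta> (S c b))"
    by (rule boundary_map[OF A \<alpha> \<beta> inj]) (rule that)
  have surj: "surj (\<lambda>c. \<alpha> c + \<beta> (S c b))" by (rule eucl.linear_inj_imp_surj[OF M])
  obtain Z where Z: "solves a b A F Z" "Z a = 0" using solves_exists[OF A F] by blast
  obtain c where c: "\<alpha> c + \<beta> (S c b) = - \<beta> (Z b)" using surjD[OF surj] by metis
  have "solves a b A F (\<lambda>s. Z s + S c s)"
    using solves_lincomb[OF A F Z(1) absolutely_integrable_0 S(1)[of c], of 1 1] by simp
  moreover have "\<alpha> (Z a + S c a) + \<beta> (Z b + S c b) = 0"
    using c Z(2) by (simp add: S(2) linear_add[OF \<beta>] eq_neg_iff_add_eq_0 add_ac)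
  ultimately show ?thesis using that unfolding bvp_solution_def by blast
qed

text \<open>
  If the homogeneous problem has only the trivial solution, then all sufficiently close problems are
  solvable, with a common bound on the solutions, and the solutions differ from those of the
  unperturbed problem by at most \<open>e\<close>, relative to the \<open>L\<^sub>1\<close> norm of the right-hand side. The constant
  \<open>\<eta>\<close> does not depend on the right-hand side.
\<close>

lemma bvp_stability:
  fixes A :: "real \<Rightarrow> 'v::euclidean_space \<Rightarrow> 'v"
  assumes A: "integrable_system a b A k" and \<alpha>: "linear \<alpha>" and \<beta>: "linear \<beta>"
    and inj: "\<forall>Y. bvp_solution a b A \<alpha> \<beta> (\<lambda>_. 0) Y \<longrightarrow> Y a = 0"
    and e: "e > 0"
  obtains \<eta> K where "\<eta> > 0" "K > 0"
    "\<And>A' \<alpha>' \<beta>' F. \<lbrakk>bvp_perturbation a b A k \<alpha> \<beta> \<eta> A' \<alpha>' \<beta>'; F absolutely_integrable_on {a..b}\<rbrakk>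
      \<Longrightarrow> \<exists>Z. bvp_solution a b A' \<alpha>' \<beta>' F Z"
    "\<And>A' \<alpha>' \<beta>' F Z t. \<lbrakk>bvp_perturbation a b A k \<alpha> \<beta> \<eta> A' \<alpha>' \<beta>'; F absolutely_integrable_on {a..b};
        bvp_solution a b A' \<alpha>' \<beta>' F Z; t \<in> {a..b}\<rbrakk>
      \<Longrightarrow> norm (Z t) \<le> K * integral {a..b} (\<lambda>s. norm (F s))"
    "\<And>A' \<alpha>' \<beta>' F Y Z t. \<lbrakk>bvp_perturbation a b A k \<alpha> \<beta> \<eta> A' \<alpha>' \<beta>'; F absolutely_integrable_on {a..b};
        bvp_solution a b A \<alpha> \<beta> F Y; bvp_solution a b A' \<alpha>' \<beta>' F Z; t \<in> {a..b}\<rbrakk>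
      \<Longrightarrow> norm (Z t - Y t) \<le> e * integral {a..b} (\<lambda>s. norm (F s))"
proof -
  have ab: "a \<in> {a..b}" "b \<in> {a..b}" and k: "k integrable_on {a..b}" using A by (auto simp: integrable_system_def)
  obtain m where m: "m > 0" and
    low: "\<And>Y. solves a b A (\<lambda>_. 0) Y \<Longrightarrow> m * norm (Y a) \<le> norm (\<alpha> (Y a) + \<beta> (Y b))"
    using boundary_map_bounded_below[OF A \<alpha> \<beta> inj] by blast
  obtain N where N: "N > 0" "\<And>v. norm (\<beta> v) \<le> N * norm v" using linear_bounded_pos[OF \<beta>] by blast
  \<comment> \<open>\<open>E\<close> is the Gronwall constant, common to all problems with \<open>\<eta> \<le> 1\<close>. Relative to the
    \<open>L\<^sub>1\<close> norm of the right-hand side, \<open>K\<close> bounds the solutions of the boundary value problems and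
    \<open>\<eta> * C\<close> bounds the defect in the perturbed boundary condition of the solution of the perturbed
    system that has the initial value of the unperturbed one.\<close>
  define E where "E = 2 * exp (2 * (integral {a..b} k + 1))"
  have E: "E > 0" by (simp add: E_def)
  define K where "K = E * ((2 / m) * (N + 1) * E + 1)"
  have K: "K > 0" using E N m by (simp add: K_def add_pos_pos)
  define C where "C = K + E * (K + 1) + N * E * K"
  have C: "C > 0" using E N K by (simp add: C_def add_pos_pos)
  define \<eta> where "\<eta> = min 1 (min (m / 2 / (1 + E + N * E * E)) (e / (E * K + E * (2 / m * C))))"
  have pos1: "1 + E + N * E * E > 0" using E N by (simp add: add_pos_pos)
  have pos2: "E * K + E * (2 / m * C) > 0" using E K C m by (simp add: add_pos_pos)
  have \<eta>: "\<eta> > 0" "\<eta> \<le> 1" using e m pos1 pos2 by (auto simp: \<eta>_def)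
  have \<eta>1: "\<eta> * (1 + E + N * E * E) \<le> m / 2"
  proof -
    have "\<eta> \<le> m / 2 / (1 + E + N * E * E)" by (simp add: \<eta>_def)
    then show ?thesis by (rule pos_le_divide_eq[OF pos1, THEN iffD1])
  qed
  have \<eta>2: "\<eta> * (E * K + E * (2 / m * C)) \<le> e"
  proof -
    have "\<eta> \<le> e / (E * K + E * (2 / m * C))" by (simp add: \<eta>_def)
    then show ?thesis by (rule pos_le_divide_eq[OF pos2, THEN iffD1])
  qed
  let ?P = "bvp_perturbation a b A k \<alpha> \<beta> \<eta>"
  have sys: "\<exists>d. integrable_system a b A' (\<lambda>t. k t + d t)" if "?P A' \<alpha>' \<beta>'" for A' \<alpha>' \<beta>'
    using bvp_perturbationE[OF that] by metis
  have expE: "2 * X * exp (2 * integral {a..b} (\<lambda>t. k t + d t)) \<le> E * X"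
    if "X \<ge> 0" "d integrable_on {a..b}" "integral {a..b} d \<le> \<eta>" for X d
  proof -
    have "integral {a..b} (\<lambda>t. k t + d t) \<le> integral {a..b} k + 1"
      using that(2,3) \<eta>(2) k by (simp add: integral_add)
    then have "exp (2 * integral {a..b} (\<lambda>t. k t + d t)) \<le> exp (2 * (integral {a..b} k + 1))" by simp
    from mult_left_mono[OF this, of "2 * X"] show ?thesis using that(1) by (simp add: E_def algebra_simps)
  qed
  have nonneg: "0 \<le> integral {a..b} (\<lambda>s. norm (F s))" if "F absolutely_integrable_on {a..b}" for F :: "real \<Rightarrow> 'v"
    using that by (intro integral_nonneg) (auto simp: absolutely_integrable_on_def)
  have ivp: "norm (Z t) \<le> E * (norm (Z a) + integral {a..b} (\<lambda>s. norm (F s)))"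
    if P: "?P A' \<alpha>' \<beta>'" and F: "F absolutely_integrable_on {a..b}" and Z: "solves a b A' F Z" and t: "t \<in> {a..b}" for A' \<alpha>' \<beta>' F Z t
  proof -
    obtain d where d: "d integrable_on {a..b}" "integral {a..b} d \<le> \<eta>" "integrable_system a b A' (\<lambda>t. k t + d t)"
      using bvp_perturbationE[OF P] by metis
    show ?thesis
      by (rule order_trans[OF solves_bound[OF d(3) F Z t] expE[OF _ d(1,2)]]) (use nonneg[OF F] in simp)
  qed
  have pert: "norm (Z t - Y t) \<le> E * (B * \<eta>)"
    if P: "?P A' \<alpha>' \<beta>'" and F: "F absolutely_integrable_on {a..b}" and Y: "solves a b A F Y" and Z: "solves a b A' F Z"
      and eq: "Z a = Y a" and B: "\<And>s. s \<in> {a..b} \<Longrightarrow> norm (Y s) \<le> B" and t: "t \<in> {a..b}" for A' \<alpha>' \<beta>' F Y Z B t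
  proof -
    obtain d where d: "d integrable_on {a..b}" "integral {a..b} d \<le> \<eta>" "integrable_system a b A' (\<lambda>t. k t + d t)"
      "\<And>s v. s \<in> {a..b} \<Longrightarrow> norm (A' s v - A s v) \<le> d s * norm v" "\<And>s. s \<in> {a..b} \<Longrightarrow> 0 \<le> d s"
      using bvp_perturbationE[OF P] by metis
    have B0: "B \<ge> 0" using B[OF ab(1)] norm_ge_zero order_trans by blast
    have d0: "0 \<le> integral {a..b} d" by (intro integral_nonneg d)
    have "norm (Z t - Y t) \<le> 2 * (norm (Z a - Y a) + B * integral {a..b} d) * exp (2 * integral {a..b} (\<lambda>t. k t + d t))"
      by (rule solves_perturb[OF A d(3) F Y Z d(1) d(4) d(5) B t])
    also have "\<dots> \<le> E * (norm (Z a - Y a) + B * integral {a..b} d)"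
      using B0 d0 by (intro expE d(1,2)) simp
    also have "\<dots> \<le> E * (B * \<eta>)" using eq E B0 d(2) by (simp add: mult_left_mono)
    finally show ?thesis .
  qed
  have \<beta>': "norm (\<beta>' v) \<le> (N + 1) * norm v" if "?P A' \<alpha>' \<beta>'" for A' \<alpha>' \<beta>' v
  proof -
    have "norm (\<beta>' v - \<beta> v) \<le> \<eta> * norm v" using that by (simp add: bvp_perturbation_def)
    also have "\<dots> \<le> 1 * norm v" using \<eta> by (intro mult_right_mono) auto
    finally have "norm (\<beta>' v) \<le> norm (\<beta> v) + norm v" using norm_triangle_sub[of "\<beta>' v" "\<beta> v"] by simp
    then show ?thesis using N(2)[of v] by (simp add: algebra_simps)
  qed
  have low': "m / 2 * norm (Z a) \<le> norm (\<alpha>' (Z a) + \<beta>' (Z b))"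
    if P: "?P A' \<alpha>' \<beta>'" and Z: "solves a b A' (\<lambda>_. 0) Z" for A' \<alpha>' \<beta>' Z
  proof -
    define z where "z = norm (Z a)"
    obtain Y where Y: "solves a b A (\<lambda>_. 0) Y" "Y a = Z a" using solves_exists[OF A absolutely_integrable_0] by blast
    have PA: "?P A \<alpha> \<beta>" unfolding bvp_perturbation_def
      using A \<alpha> \<beta> \<eta> by (auto intro!: exI[of _ "\<lambda>_. 0"])
    have bY: "norm (Y t) \<le> E * z" if "t \<in> {a..b}" for t
      using ivp[OF PA absolutely_integrable_0 Y(1) that] Y(2) by (simp add: z_def)
    have bZ: "norm (Z b) \<le> E * z"
      using ivp[OF P absolutely_integrable_0 Z ab(2)] by (simp add: z_def)
    have "norm (Z b - Y b) \<le> E * (E * z * \<eta>)"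
      by (rule pert[OF P absolutely_integrable_0 Y(1) Z _ bY ab(2)]) (simp add: Y(2))
    then have d3: "norm (\<beta> (Z b - Y b)) \<le> N * (E * (E * z * \<eta>))"
      using N order_trans[OF N(2)] by (meson mult_left_mono less_imp_le order_trans)
    have d1: "norm (\<alpha>' (Z a) - \<alpha> (Z a)) \<le> \<eta> * z" using P by (simp add: bvp_perturbation_def z_def)
    have "norm (\<beta>' (Z b) - \<beta> (Z b)) \<le> \<eta> * norm (Z b)" using P by (simp add: bvp_perturbation_def)
    also have "\<dots> \<le> \<eta> * (E * z)" using bZ \<eta> by (intro mult_left_mono) auto
    finally have d2: "norm (\<beta>' (Z b) - \<beta> (Z b)) \<le> \<eta> * (E * z)" .
    have "\<alpha> (Y a) + \<beta> (Y b) = (\<alpha>' (Z a) + \<beta>' (Z b)) - ((\<alpha>' (Z a) - \<alpha> (Z a)) + (\<beta>' (Z b) - \<beta> (Z b)) + \<beta> (Z b - Y b))"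
      by (simp add: Y(2) linear_diff[OF \<beta>])
    also have "norm \<dots> \<le> norm (\<alpha>' (Z a) + \<beta>' (Z b)) + norm ((\<alpha>' (Z a) - \<alpha> (Z a)) + (\<beta>' (Z b) - \<beta> (Z b)) + \<beta> (Z b - Y b))"
      by (rule norm_triangle_ineq4)
    also have "norm ((\<alpha>' (Z a) - \<alpha> (Z a)) + (\<beta>' (Z b) - \<beta> (Z b)) + \<beta> (Z b - Y b)) \<le> \<eta> * z + \<eta> * (E * z) + N * (E * (E * z * \<eta>))"
      by (intro norm_triangle_mono d1 d2 d3)
    also have "\<dots> = \<eta> * (1 + E + N * E * E) * z" by (simp add: algebra_simps)
    also have "\<dots> \<le> m / 2 * z" using \<eta>1 by (intro mult_right_mono) (auto simp: z_def)
    finally have "norm (\<alpha> (Y a) + \<beta> (Y b)) \<le> norm (\<alpha>' (Z a) + \<beta>' (Z b)) + m / 2 * z" by simp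
    moreover have "m * z \<le> norm (\<alpha> (Y a) + \<beta> (Y b))" using low[OF Y(1)] by (simp add: Y(2) z_def)
    ultimately show ?thesis unfolding z_def by simp
  qed
  have bound: "norm (Z a) \<le> (2 / m) * (N + 1) * E * integral {a..b} (\<lambda>s. norm (F s))"
    "t \<in> {a..b} \<Longrightarrow> norm (Z t) \<le> K * integral {a..b} (\<lambda>s. norm (F s))"
    if P: "?P A' \<alpha>' \<beta>'" and F: "F absolutely_integrable_on {a..b}" and Z: "bvp_solution a b A' \<alpha>' \<beta>' F Z" for A' \<alpha>' \<beta>' F Z t
  proof -
    define n where "n = integral {a..b} (\<lambda>s. norm (F s))"
    obtain d where A': "integrable_system a b A' (\<lambda>t. k t + d t)" using sys[OF P] by blast
    have lin: "linear \<beta>'" using P by (simp add: bvp_perturbation_def)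
    have Zs: "solves a b A' F Z" and bc: "\<alpha>' (Z a) + \<beta>' (Z b) = 0" using Z by (auto simp: bvp_solution_def)
    obtain W where W: "solves a b A' F W" "W a = 0" using solves_exists[OF A' F] by blast
    have "m / 2 * norm (Z a) \<le> norm (\<alpha>' (Z a) + \<beta>' (Z b - W b))"
      using low'[OF P solves_diff[OF A' F Zs W(1)]] by (simp add: W(2))
    also have "\<alpha>' (Z a) + \<beta>' (Z b - W b) = - \<beta>' (W b)" using bc by (simp add: linear_diff[OF lin] algebra_simps)
    also have "norm (- \<beta>' (W b)) \<le> (N + 1) * norm (W b)" using \<beta>'[OF P] by simp
    also have "\<dots> \<le> (N + 1) * (E * n)"
      using ivp[OF P F W(1) ab(2)] N by (intro mult_left_mono) (auto simp: W(2) n_def)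
    finally have "norm (Z a) \<le> (2 / m) * ((N + 1) * (E * n))"
      using m by (simp add: field_simps)
    then show a: "norm (Z a) \<le> (2 / m) * (N + 1) * E * integral {a..b} (\<lambda>s. norm (F s))"
      by (simp only: n_def mult.assoc)
    assume t: "t \<in> {a..b}"
    have "norm (Z t) \<le> E * (norm (Z a) + n)" unfolding n_def by (rule ivp[OF P F Zs t])
    also have "\<dots> \<le> E * ((2 / m) * (N + 1) * E * n + n)" using a E by (intro mult_left_mono) (auto simp: n_def)
    also have "\<dots> = K * n" by (simp add: K_def algebra_simps)
    finally show "norm (Z t) \<le> K * integral {a..b} (\<lambda>s. norm (F s))" by (simp add: n_def)
  qed
  show ?thesis
  proof (rule that[of \<eta> K])
    fix A' \<alpha>' \<beta>' and F :: "real \<Rightarrow> 'v"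
    assume P: "?P A' \<alpha>' \<beta>'" and F: "F absolutely_integrable_on {a..b}"
    obtain d where A': "integrable_system a b A' (\<lambda>t. k t + d t)" using sys[OF P] by blast
    have lin: "linear \<alpha>'" "linear \<beta>'" using P by (auto simp: bvp_perturbation_def)
    have inj': "\<forall>Y. bvp_solution a b A' \<alpha>' \<beta>' (\<lambda>_. 0) Y \<longrightarrow> Y a = 0"
      using bound(1)[OF P absolutely_integrable_0] by simp
    from bvp_exists[OF A' lin inj' F] show "\<exists>Z. bvp_solution a b A' \<alpha>' \<beta>' F Z" by blast
  next
    fix A' \<alpha>' \<beta>' t and F Z :: "real \<Rightarrow> 'v"
    assume "?P A' \<alpha>' \<beta>'" "F absolutely_integrable_on {a..b}" "bvp_solution a b A' \<alpha>' \<beta>' F Z" "t \<in> {a..b}"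
    then show "norm (Z t) \<le> K * integral {a..b} (\<lambda>s. norm (F s))" by (rule bound(2))
  next
    fix A' \<alpha>' \<beta>' t and F Y Z :: "real \<Rightarrow> 'v"
    assume P: "?P A' \<alpha>' \<beta>'" and F: "F absolutely_integrable_on {a..b}"
      and Y: "bvp_solution a b A \<alpha> \<beta> F Y" and Z: "bvp_solution a b A' \<alpha>' \<beta>' F Z" and t: "t \<in> {a..b}"
    define n where "n = integral {a..b} (\<lambda>s. norm (F s))"
    have n0: "n \<ge> 0" unfolding n_def by (rule nonneg[OF F])
    obtain d where A': "integrable_system a b A' (\<lambda>t. k t + d t)" using sys[OF P] by blast
    have lin: "linear \<alpha>'" "linear \<beta>'" using P by (auto simp: bvp_perturbation_def)
    have PA: "?P A \<alpha> \<beta>" unfolding bvp_perturbation_def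
      using A \<alpha> \<beta> \<eta> by (auto intro!: exI[of _ "\<lambda>_. 0"])
    have Ys: "solves a b A F Y" and bcY: "\<alpha> (Y a) + \<beta> (Y b) = 0" using Y by (auto simp: bvp_solution_def)
    have Zs: "solves a b A' F Z" and bcZ: "\<alpha>' (Z a) + \<beta>' (Z b) = 0" using Z by (auto simp: bvp_solution_def)
    have bY: "norm (Y t) \<le> K * n" if "t \<in> {a..b}" for t
      unfolding n_def by (rule bound(2)[OF PA F Y that])
    \<comment> \<open>\<open>W\<close> is compared with \<open>Y\<close> as an initial value problem and with \<open>Z\<close> through the boundary values.\<close>
    obtain W where W: "solves a b A' F W" "W a = Y a" using solves_exists[OF A' F] by blast
    have WY: "norm (W t - Y t) \<le> E * (K * n * \<eta>)" if "t \<in> {a..b}" for t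
      by (rule pert[OF P F Ys W bY that])
    have "norm (W b) \<le> E * (norm (Y a) + n)" using ivp[OF P F W(1) ab(2)] by (simp add: W(2) n_def)
    also have "\<dots> \<le> E * (K * n + n)" using bY[OF ab(1)] E by (intro mult_left_mono) auto
    finally have bW: "norm (W b) \<le> E * (K + 1) * n" by (simp add: algebra_simps)
    have d1: "norm (\<alpha>' (Y a) - \<alpha> (Y a)) \<le> \<eta> * (K * n)"
    proof -
      have "norm (\<alpha>' (Y a) - \<alpha> (Y a)) \<le> \<eta> * norm (Y a)" using P by (simp add: bvp_perturbation_def)
      also have "\<dots> \<le> \<eta> * (K * n)" using bY[OF ab(1)] \<eta> by (intro mult_left_mono) auto
      finally show ?thesis .
    qed
    have d2: "norm (\<beta>' (W b) - \<beta> (W b)) \<le> \<eta> * (E * (K + 1) * n)"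
    proof -
      have "norm (\<beta>' (W b) - \<beta> (W b)) \<le> \<eta> * norm (W b)" using P by (simp add: bvp_perturbation_def)
      also have "\<dots> \<le> \<eta> * (E * (K + 1) * n)" using bW \<eta> by (intro mult_left_mono) auto
      finally show ?thesis .
    qed
    have d3: "norm (\<beta> (W b - Y b)) \<le> N * (E * (K * n * \<eta>))"
    proof -
      have "norm (\<beta> (W b - Y b)) \<le> N * norm (W b - Y b)" by (rule N(2))
      also have "\<dots> \<le> N * (E * (K * n * \<eta>))" using WY[OF ab(2)] N by (intro mult_left_mono) auto
      finally show ?thesis .
    qed
    have "m / 2 * norm (Z a - W a) \<le> norm (\<alpha>' (Z a - W a) + \<beta>' (Z b - W b))"
      by (rule low'[OF P solves_diff[OF A' F Zs W(1)]])
    also have "\<alpha>' (Z a - W a) + \<beta>' (Z b - W b) = - ((\<alpha>' (Y a) - \<alpha> (Y a)) + (\<beta>' (W b) - \<beta> (W b)) + \<beta> (W b - Y b))"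
      using bcY bcZ by (simp add: W(2) linear_diff[OF lin(1)] linear_diff[OF lin(2)] linear_diff[OF \<beta>] algebra_simps eq_neg_iff_add_eq_0)
    also have "norm \<dots> \<le> \<eta> * (K * n) + \<eta> * (E * (K + 1) * n) + N * (E * (K * n * \<eta>))"
      unfolding norm_minus_cancel by (intro norm_triangle_mono d1 d2 d3)
    also have "\<dots> = \<eta> * C * n" by (simp add: C_def algebra_simps)
    finally have ZWa: "norm (Z a - W a) \<le> \<eta> * (2 / m * C) * n" using m by (simp add: field_simps)
    have "norm (Z t - W t) \<le> E * norm (Z a - W a)"
      using ivp[OF P absolutely_integrable_0 solves_diff[OF A' F Zs W(1)] t] by simp
    also have "\<dots> \<le> E * (\<eta> * (2 / m * C) * n)" using ZWa E by (intro mult_left_mono) auto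
    finally have "norm (Z t - W t) \<le> E * (\<eta> * (2 / m * C) * n)" .
    then have "norm (Z t - Y t) \<le> E * (\<eta> * (2 / m * C) * n) + E * (K * n * \<eta>)"
      using WY[OF t] norm_triangle_ineq[of "Z t - W t" "W t - Y t"] by simp
    also have "\<dots> = \<eta> * (E * K + E * (2 / m * C)) * n" by (simp add: algebra_simps)
    also have "\<dots> \<le> e * n" using \<eta>2 n0 by (intro mult_right_mono)
    finally show "norm (Z t - Y t) \<le> e * integral {a..b} (\<lambda>s. norm (F s))" by (simp add: n_def)
  qed (use \<eta> K in auto)
qed

section \<open>Matrices and square-integrable functions\<close>

lemma norm_matrix_vector_mult_le:
  fixes M :: "complex^'n^'m"
  shows "norm (M *v v) \<le> norm M * norm v"
proof -
  have "norm (M *v v) = L2_set (\<lambda>i. norm (\<Sum>j\<in>UNIV. M $ i $ j * v $ j)) UNIV"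
    by (simp add: norm_vec_def matrix_vector_mult_def)
  also have "\<dots> \<le> L2_set (\<lambda>i. norm (M $ i) * norm v) UNIV"
  proof (intro L2_set_mono)
    fix i
    have "norm (\<Sum>j\<in>UNIV. M $ i $ j * v $ j) \<le> (\<Sum>j\<in>UNIV. \<bar>norm (M $ i $ j)\<bar> * \<bar>norm (v $ j)\<bar>)"
      by (rule sum_norm_le) (simp add: norm_mult)
    also have "\<dots> \<le> norm (M $ i) * norm v"
      unfolding norm_vec_def by (rule L2_set_mult_ineq)
    finally show "norm (\<Sum>j\<in>UNIV. M $ i $ j * v $ j) \<le> norm (M $ i) * norm v" .
  qed simp
  also have "\<dots> = norm M * norm v" by (simp add: norm_vec_def[of M] L2_set_left_distrib)
  finally show ?thesis .
qed

lemma norm_vector_scalar_mult: "norm (c *s (v :: complex^'n)) = norm c * norm v"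
  by (simp add: norm_vec_def norm_mult L2_set_right_distrib)

lemma linear_vector_scalar_mult: "linear (\<lambda>v :: complex^'n. c *s v)"
  by (rule linearI) (simp_all add: vec_eq_iff algebra_simps)

lemma linear_matrix_argument: "linear (\<lambda>M :: complex^'n^'m. M *v v)"
  by (rule linearI) (simp_all add: vec_eq_iff matrix_vector_mult_def sum.distrib scaleR_sum_right algebra_simps)

lemma matrix_inv_mult:
  fixes M :: "complex^'n^'n"
  assumes "invertible M"
  shows "M ** matrix_inv M = mat 1" "matrix_inv M ** M = mat 1"
  using someI_ex[OF assms[unfolded invertible_def]] by (auto simp: matrix_inv_def)

lemma integrable_leb_iff:
  fixes f :: "real \<Rightarrow> 'v::euclidean_space"
  shows "integrable (leb a b) f \<longleftrightarrow> f absolutely_integrable_on {a..b}"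
  unfolding absolutely_integrable_on_Icc_iff_Ioo
  by (simp add: integrable_restrict_space set_integrable_def)

lemma integral_leb_eq:
  fixes f :: "real \<Rightarrow> 'v::euclidean_space"
  assumes "integrable (leb a b) f"
  shows "integral\<^sup>L (leb a b) f = integral {a..b} f"
  using lebesgue_integral_eq_integral[OF assms] by (simp add: integral_open_interval_real)

text \<open>
  Statements almost everywhere on \<open>(a, b)\<close>, in terms of the negligible sets of gauge integration.
\<close>

lemma AE_leb_iff:
  "(AE t in leb a b. P t) \<longleftrightarrow> (\<exists>N. negligible N \<and> (\<forall>t\<in>{a<..<b} - N. P t))"
proof -
  have "(AE t in leb a b. P t) \<longleftrightarrow> (AE t in lebesgue. t \<in> {a<..<b} \<longrightarrow> P t)"
    by (simp add: AE_restrict_space_iff)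
  also have "\<dots> \<longleftrightarrow> (\<exists>N. negligible N \<and> (\<forall>t\<in>{a<..<b} - N. P t))"
    unfolding eventually_ae_filter_negligible by (intro ex_cong1) auto
  finally show ?thesis .
qed

lemma integrable_leb_const: "integrable (leb a b) (\<lambda>_. c::real)"
  by (simp add: integrable_leb_iff)

lemma integral_leb_const: "a < b \<Longrightarrow> (\<integral>t. c \<partial>leb a b) = (b - a) * (c::real)"
  by (subst integral_leb_eq[OF integrable_leb_const]) simp

lemma continuous_AE_eq_imp_eq:
  fixes f g :: "real \<Rightarrow> 'v::euclidean_space"
  assumes ab: "a < b" and f: "continuous_on {a..b} f" and g: "continuous_on {a..b} g"
    and ae: "AE t in leb a b. f t = g t" and t: "t \<in> {a..b}"
  shows "f t = g t"
proof -
  define h where "h t = f t - g t" for t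
  have h: "continuous_on {a..b} h" unfolding h_def by (intro continuous_intros f g)
  obtain N where N: "negligible N" "\<And>t. t \<in> {a<..<b} - N \<Longrightarrow> h t = 0" using ae unfolding AE_leb_iff h_def by auto
  have "h t = 0" if "t \<in> {a<..<b}" for t
  proof (rule ccontr)
    assume "h t \<noteq> 0"
    have "continuous_on {a<..<b} h" by (rule continuous_on_subset[OF h]) auto
    then have "open (h -` (- {0}) \<inter> {a<..<b})"
      by (intro continuous_on_open_vimage[THEN iffD1, rule_format]) auto
    moreover have "t \<in> h -` (- {0}) \<inter> {a<..<b}" using \<open>h t \<noteq> 0\<close> that by simp
    ultimately have "\<not> negligible (h -` (- {0}) \<inter> {a<..<b})" using open_not_negligible by blast
    moreover have "h -` (- {0}) \<inter> {a<..<b} \<subseteq> N" using N(2) by blast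
    ultimately show False using N(1) negligible_subset by blast
  qed
  moreover have "continuous_on (closure {a<..<b}) h" using h ab by simp
  ultimately have "h t = 0"
    using continuous_constant_on_closure[of "{a<..<b}" h 0 t] t ab by auto
  then show ?thesis by (simp add: h_def)
qed

lemma L2_I_bounded:
  assumes "f \<in> borel_measurable (leb a b)" "\<And>t. t \<in> {a<..<b} \<Longrightarrow> norm (f t) \<le> B"
  shows "f \<in> L2 a b"
  unfolding L2_def
proof (intro CollectI conjI assms)
  have c: "integrable (leb a b) (\<lambda>_. B\<^sup>2)" by (simp add: integrable_leb_iff)
  have m: "(\<lambda>t. (norm (f t))\<^sup>2) \<in> borel_measurable (leb a b)" using assms(1) by measurable
  show "integrable (leb a b) (\<lambda>t. (norm (f t))\<^sup>2)"
    by (rule Bochner_Integration.integrable_bound[OF c m]) (use assms(2) in \<open>auto intro!: AE_I2 power_mono simp: power2_abs\<close>)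
qed

lemma L2_continuous:
  assumes "continuous_on {a..b} f"
  shows "f \<in> L2 a b"
proof -
  have "bounded (f ` {a..b})" by (rule compact_imp_bounded[OF compact_continuous_image[OF assms compact_Icc]])
  then obtain B where "\<And>t. t \<in> {a..b} \<Longrightarrow> norm (f t) \<le> B" unfolding bounded_iff by blast
  moreover have "f \<in> borel_measurable (leb a b)"
    by (rule continuous_imp_measurable_on_sets_lebesgue[OF continuous_on_subset[OF assms]]) auto
  ultimately show ?thesis by (intro L2_I_bounded[of f a b B]) auto
qed

lemma L2_add_scaled:
  assumes f: "f \<in> L2 a b" and g: "g \<in> L2 a b"
  shows "(\<lambda>t. f t + c *s g t) \<in> L2 a b"
proof -
  have m: "f \<in> borel_measurable (leb a b)" "g \<in> borel_measurable (leb a b)"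
    and i: "integrable (leb a b) (\<lambda>t. (norm (f t))\<^sup>2)" "integrable (leb a b) (\<lambda>t. (norm (g t))\<^sup>2)"
    using f g by (auto simp: L2_def)
  have cs: "(\<lambda>v::complex^'a. c *s v) \<in> borel_measurable borel"
    by (intro borel_measurable_continuous_onI linear_continuous_on linear_conv_bounded_linear[THEN iffD1] linear_vector_scalar_mult)
  have mf: "(\<lambda>t. f t + c *s g t) \<in> borel_measurable (leb a b)"
    using m measurable_compose[OF m(2) cs] by (intro borel_measurable_add)
  have bd: "integrable (leb a b) (\<lambda>t. 2 * (norm (f t))\<^sup>2 + 2 * (norm c)\<^sup>2 * (norm (g t))\<^sup>2)"
    using i by (intro Bochner_Integration.integrable_add integrable_mult_right)
  have "(norm (f t + c *s g t))\<^sup>2 \<le> 2 * (norm (f t))\<^sup>2 + 2 * (norm c)\<^sup>2 * (norm (g t))\<^sup>2" for t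
  proof -
    have "norm (f t + c *s g t) \<le> norm (f t) + norm c * norm (g t)"
      by (metis norm_triangle_ineq norm_vector_scalar_mult)
    then have "(norm (f t + c *s g t))\<^sup>2 \<le> (norm (f t) + norm c * norm (g t))\<^sup>2" by (intro power_mono) auto
    also have "\<dots> \<le> 2 * (norm (f t))\<^sup>2 + 2 * (norm c * norm (g t))\<^sup>2"
      using sum_squares_bound[of "norm (f t)" "norm c * norm (g t)"] by (simp add: power2_sum)
    finally show ?thesis by (simp add: power_mult_distrib)
  qed
  then have "integrable (leb a b) (\<lambda>t. (norm (f t + c *s g t))\<^sup>2)"
    using mf by (intro Bochner_Integration.integrable_bound[OF bd]) auto
  then show ?thesis using mf by (simp add: L2_def)
qed

text \<open>
  Square-integrable functions on a bounded interval are integrable. The inequality is the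
  Cauchy-Schwarz inequality for the functions \<open>norm f\<close> and \<open>1\<close>.
\<close>

lemma L2_Cauchy_Schwarz:
  assumes ab: "a < b" and f: "f \<in> L2 a b"
  shows "f absolutely_integrable_on {a..b}"
    and "integral {a..b} (\<lambda>t. norm (f t)) \<le> sqrt (b - a) * L2_norm a b f"
proof -
  have m: "f \<in> borel_measurable (leb a b)" and i2: "integrable (leb a b) (\<lambda>t. (norm (f t))\<^sup>2)"
    using f by (auto simp: L2_def)
  have bd: "integrable (leb a b) (\<lambda>t. 1 + (norm (f t))\<^sup>2)" by (intro Bochner_Integration.integrable_add integrable_leb_const i2)
  have le: "norm x \<le> 1 + (norm x)\<^sup>2" for x :: "complex^'a"
    using sum_squares_bound[of 1 "norm x"] norm_ge_zero[of x] unfolding power_one by linarith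
  have fi: "integrable (leb a b) f"
    by (rule Bochner_Integration.integrable_bound[OF bd m]) (use le in \<open>auto intro!: AE_I2 intro: order_trans\<close>)
  then show "f absolutely_integrable_on {a..b}" by (simp add: integrable_leb_iff)
  have ni: "integrable (leb a b) (\<lambda>t. norm (f t))" using fi by simp
  define I where "I = (\<integral>t. norm (f t) \<partial>leb a b)"
  define S where "S = (\<integral>t. (norm (f t))\<^sup>2 \<partial>leb a b)"
  \<comment> \<open>With \<open>c\<close> the mean value, the claim is that the variance of \<open>norm f\<close> is nonnegative.\<close>
  define c where "c = I / (b - a)"
  have "0 \<le> (\<integral>t. (norm (f t) - c)\<^sup>2 \<partial>leb a b)" by (rule Bochner_Integration.integral_nonneg) simp
  also have "\<dots> = (\<integral>t. ((norm (f t))\<^sup>2 - 2 * c * norm (f t)) + c\<^sup>2 \<partial>leb a b)"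
    by (intro Bochner_Integration.integral_cong refl) (simp add: power2_diff)
  also have "\<dots> = S - 2 * c * I + (b - a) * c\<^sup>2"
    using ni i2 integrable_leb_const ab by (simp add: S_def I_def integral_leb_const del: lebesgue_integral_const)
  finally have "2 * c * I - (b - a) * c\<^sup>2 \<le> S" by simp
  moreover have I: "I = (b - a) * c" using ab by (simp add: c_def)
  ultimately have "(b - a) * c\<^sup>2 \<le> S" by (simp add: power2_eq_square algebra_simps)
  from mult_left_mono[OF this, of "b - a"] ab have "I\<^sup>2 \<le> (b - a) * S"
    unfolding I by (simp add: power2_eq_square mult_ac)
  then have "I \<le> sqrt ((b - a) * S)" by (rule real_le_rsqrt)
  then show "integral {a..b} (\<lambda>t. norm (f t)) \<le> sqrt (b - a) * L2_norm a b f"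
    by (simp add: real_sqrt_mult L2_norm_def S_def I_def integral_leb_eq[OF ni])
qed

lemma L2_norm_le:
  assumes ab: "a < b" and B: "0 \<le> B" and le: "\<And>t. t \<in> {a<..<b} \<Longrightarrow> norm (f t) \<le> B"
  shows "L2_norm a b f \<le> sqrt (b - a) * B"
proof -
  have "(\<integral>t. (norm (f t))\<^sup>2 \<partial>leb a b) \<le> (\<integral>t. B\<^sup>2 \<partial>leb a b)"
    using le by (intro Bochner_Integration.integral_mono' integrable_leb_const) (auto intro!: power_mono)
  also have "\<dots> = (b - a) * B\<^sup>2"
    by (rule integral_leb_const[OF ab])
  finally have "L2_norm a b f \<le> sqrt ((b - a) * B\<^sup>2)" unfolding L2_norm_def by (rule real_sqrt_le_mono)
  then show ?thesis using B by (simp add: real_sqrt_mult)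
qed

section \<open>The first-order system of the quasi-differential expression\<close>

text \<open>
  The coefficients of the system for the pair of \<open>y\<close> and its quasi-derivative that is equivalent to
  \<open>l y - \<mu> y = f\<close> with right-hand side \<open>(0, -f)\<close>.
\<close>

definition qd_system ::
    "(real \<Rightarrow> complex^'s^'s) \<Rightarrow> (real \<Rightarrow> complex^'s^'s) \<Rightarrow> complex \<Rightarrow> real
      \<Rightarrow> (complex^'s) \<times> (complex^'s) \<Rightarrow> (complex^'s) \<times> (complex^'s)" where
  "qd_system p Q \<mu> t v =
     ((matrix_inv (p t) ** Q t) *v fst v + matrix_inv (p t) *v snd v,
      - ((Q t ** matrix_inv (p t) ** Q t) *v fst v) - (Q t ** matrix_inv (p t)) *v snd v - \<mu> *s fst v)"

text \<open>
  The identification of pairs of vectors with vectors of dimension \<open>2 * s\<close>; its inverse is \<open>split_vec\<close>.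
\<close>

definition join_vec :: "(complex^'s) \<times> (complex^'s) \<Rightarrow> complex^('s + 's)" where
  "join_vec v = (\<chi> i. case i of Inl j \<Rightarrow> fst v $ j | Inr j \<Rightarrow> snd v $ j)"

definition split_vec :: "complex^('s + 's) \<Rightarrow> (complex^'s) \<times> (complex^'s)" where
  "split_vec w = (\<chi> j. w $ Inl j, \<chi> j. w $ Inr j)"

text \<open>
  The matrix of a boundary condition, transported to the space of pairs.
\<close>

definition bdry_map :: "complex^('s + 's)^('s + 's) \<Rightarrow> (complex^'s) \<times> (complex^'s) \<Rightarrow> (complex^'s) \<times> (complex^'s)" where
  "bdry_map \<alpha> v = split_vec (\<alpha> *v join_vec v)"

lemma linear_join_vec: "linear join_vec"
  by (rule linearI) (auto simp: join_vec_def vec_eq_iff split: sum.splits)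

lemma linear_split_vec: "linear split_vec"
  by (rule linearI) (auto simp: split_vec_def vec_eq_iff)

lemma linear_bdry_map: "linear (bdry_map \<alpha>)"
  unfolding bdry_map_def
  using linear_compose[OF linear_compose[OF linear_join_vec matrix_vector_mul_linear] linear_split_vec]
  by (simp add: o_def)

lemma split_vec_eq_0_iff: "split_vec w = 0 \<longleftrightarrow> w = 0"
proof
  assume *: "split_vec w = 0"
  have "w $ i = 0" for i
    using * by (cases i) (auto simp: split_vec_def vec_eq_iff zero_prod_def)
  then show "w = 0" by (simp add: vec_eq_iff)
qed (simp add: linear_0[OF linear_split_vec])

lemma bdry_condition_iff:
  "\<alpha> *v bdry_vec y u a + \<beta> *v bdry_vec y u b = 0 \<longleftrightarrow> bdry_map \<alpha> (y a, u a) + bdry_map \<beta> (y b, u b) = 0"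
proof -
  have "bdry_vec y u c = join_vec (y c, u c)" for c
    by (simp only: bdry_vec_def join_vec_def fst_conv snd_conv)
  then show ?thesis
    by (simp add: bdry_map_def linear_add[OF linear_split_vec, symmetric] split_vec_eq_0_iff)
qed

lemma bdry_map_diff_le:
  obtains C where "C > 0"
    "\<And>\<alpha> \<alpha>' v. norm (bdry_map \<alpha>' v - bdry_map \<alpha> v :: (complex^'s::finite) \<times> _) \<le> C * norm (\<alpha>' - \<alpha>) * norm v"
proof -
  obtain B where B: "B > 0" "\<And>v :: (complex^'s) \<times> (complex^'s). norm (join_vec v) \<le> B * norm v"
    using linear_bounded_pos[OF linear_join_vec] by blast
  obtain D where D: "D > 0" "\<And>w :: complex^('s + 's). norm (split_vec w) \<le> D * norm w"
    using linear_bounded_pos[OF linear_split_vec] by blast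
  have "norm (bdry_map \<alpha>' v - bdry_map \<alpha> v) \<le> D * B * norm (\<alpha>' - \<alpha>) * norm v"
    for \<alpha> \<alpha>' :: "complex^('s + 's)^('s + 's)" and v
  proof -
    have "bdry_map \<alpha>' v - bdry_map \<alpha> v = split_vec ((\<alpha>' - \<alpha>) *v join_vec v)"
      by (simp add: bdry_map_def linear_diff[OF linear_split_vec, symmetric] matrix_vector_mult_diff_rdistrib)
    also have "norm \<dots> \<le> D * norm ((\<alpha>' - \<alpha>) *v join_vec v)" by (rule D(2))
    also have "\<dots> \<le> D * (norm (\<alpha>' - \<alpha>) * norm (join_vec v))"
      using D(1) by (intro mult_left_mono norm_matrix_vector_mult_le) auto
    also have "\<dots> \<le> D * (norm (\<alpha>' - \<alpha>) * (B * norm v))"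
      using D(1) B by (intro mult_left_mono) auto
    finally show ?thesis by (simp add: mult_ac)
  qed
  then show ?thesis using that[of "D * B"] B(1) D(1) by simp
qed

lemma admissible_coeffs_integrable:
  assumes "admissible_coeffs a b p Q"
  shows "(\<lambda>t. matrix_inv (p t)) absolutely_integrable_on {a..b}"
    and "(\<lambda>t. matrix_inv (p t) ** Q t) absolutely_integrable_on {a..b}"
    and "(\<lambda>t. Q t ** matrix_inv (p t)) absolutely_integrable_on {a..b}"
    and "(\<lambda>t. Q t ** matrix_inv (p t) ** Q t) absolutely_integrable_on {a..b}"
  using assms by (simp_all add: admissible_coeffs_def integrable_leb_iff)

text \<open>
  A majorant of the operator norm of \<^const>\<open>qd_system\<close>.
\<close>

definition qd_bound :: "(real \<Rightarrow> complex^'s^'s) \<Rightarrow> (real \<Rightarrow> complex^'s^'s) \<Rightarrow> complex \<Rightarrow> real \<Rightarrow> real" where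
  "qd_bound p Q \<mu> t = norm (matrix_inv (p t) ** Q t) + norm (matrix_inv (p t)) +
     norm (Q t ** matrix_inv (p t) ** Q t) + norm (Q t ** matrix_inv (p t)) + norm \<mu>"

text \<open>
  A majorant of the operator norm of the difference of two systems. Its integral is the sum of the
  four \<open>L\<^sub>1\<close> distances of the coefficients, and it does not depend on \<open>\<mu>\<close>.
\<close>

definition qd_distance ::
   "(real \<Rightarrow> complex^'s^'s) \<Rightarrow> (real \<Rightarrow> complex^'s^'s) \<Rightarrow> (real \<Rightarrow> complex^'s^'s) \<Rightarrow> (real \<Rightarrow> complex^'s^'s) \<Rightarrow> real \<Rightarrow> real" where
  "qd_distance p Q p' Q' t = norm (matrix_inv (p' t) ** Q' t - matrix_inv (p t) ** Q t) +
     norm (matrix_inv (p' t) - matrix_inv (p t)) +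
     norm (Q' t ** matrix_inv (p' t) ** Q' t - Q t ** matrix_inv (p t) ** Q t) +
     norm (Q' t ** matrix_inv (p' t) - Q t ** matrix_inv (p t))"

lemma qd_distance_nonneg: "0 \<le> qd_distance p Q p' Q' t"
  by (simp add: qd_distance_def)

lemma norm_fst_le_norm: "norm (fst v) \<le> norm v"
  by (metis norm_fst_le prod.collapse)

lemma norm_snd_le_norm: "norm (snd v) \<le> norm v"
  by (metis norm_snd_le prod.collapse)

lemma block_norm_le:
  fixes M1 M2 M3 M4 :: "complex^'s^'s"
  shows "norm ((M1 *v fst v + M2 *v snd v, - (M3 *v fst v) - M4 *v snd v - \<mu> *s fst v))
     \<le> (norm M1 + norm M2 + norm M3 + norm M4 + norm \<mu>) * norm v"
proof -
  note fs = norm_fst_le_norm[of v] norm_snd_le_norm[of v]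
  have M: "norm (M *v fst v) \<le> norm M * norm v" "norm (M *v snd v) \<le> norm M * norm v" for M :: "complex^'s^'s"
    by (rule order_trans[OF norm_matrix_vector_mult_le mult_left_mono[OF fs(1) norm_ge_zero]],
        rule order_trans[OF norm_matrix_vector_mult_le mult_left_mono[OF fs(2) norm_ge_zero]])
  have m: "norm (\<mu> *s fst v) \<le> norm \<mu> * norm v"
    using fs by (simp add: norm_vector_scalar_mult mult_left_mono)
  have "norm ((M1 *v fst v + M2 *v snd v, - (M3 *v fst v) - M4 *v snd v - \<mu> *s fst v))
     \<le> norm (M1 *v fst v + M2 *v snd v) + norm (- (M3 *v fst v) - M4 *v snd v - \<mu> *s fst v)"
    by (rule norm_Pair_le)
  also have "\<dots> \<le> (norm M1 * norm v + norm M2 * norm v) + (norm M3 * norm v + norm M4 * norm v + norm \<mu> * norm v)"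
  proof (rule add_mono)
    show "norm (M1 *v fst v + M2 *v snd v) \<le> norm M1 * norm v + norm M2 * norm v"
      by (intro norm_triangle_mono M)
    have "norm (- (M3 *v fst v) - M4 *v snd v - \<mu> *s fst v) \<le> norm (- (M3 *v fst v)) + norm (M4 *v snd v) + norm (\<mu> *s fst v)"
      by (rule order_trans[OF norm_triangle_ineq4 add_right_mono[OF norm_triangle_ineq4]])
    then show "norm (- (M3 *v fst v) - M4 *v snd v - \<mu> *s fst v) \<le> norm M3 * norm v + norm M4 * norm v + norm \<mu> * norm v"
      using M(1)[of M3] M(2)[of M4] m by simp
  qed
  finally show ?thesis by (simp add: algebra_simps)
qed

lemma norm_qd_system_le: "norm (qd_system p Q \<mu> t v) \<le> qd_bound p Q \<mu> t * norm v"
  unfolding qd_system_def qd_bound_def by (rule block_norm_le)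

lemma norm_qd_system_diff_le:
  "norm (qd_system p' Q' \<mu> t v - qd_system p Q \<mu> t v) \<le> qd_distance p Q p' Q' t * norm v"
proof -
  have "qd_system p' Q' \<mu> t v - qd_system p Q \<mu> t v =
     ((matrix_inv (p' t) ** Q' t - matrix_inv (p t) ** Q t) *v fst v + (matrix_inv (p' t) - matrix_inv (p t)) *v snd v,
      - ((Q' t ** matrix_inv (p' t) ** Q' t - Q t ** matrix_inv (p t) ** Q t) *v fst v)
       - (Q' t ** matrix_inv (p' t) - Q t ** matrix_inv (p t)) *v snd v - 0 *s fst v)"
    by (simp add: qd_system_def matrix_vector_mult_diff_rdistrib)
  also have "norm \<dots> \<le> qd_distance p Q p' Q' t * norm v"
    by (rule order_trans[OF block_norm_le]) (simp add: qd_distance_def)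
  finally show ?thesis .
qed

lemma qd_bound_integrable:
  assumes "admissible_coeffs a b p Q"
  shows "qd_bound p Q \<mu> integrable_on {a..b}"
  using admissible_coeffs_integrable[OF assms] unfolding qd_bound_def[abs_def]
  by (intro integrable_add) (auto simp: absolutely_integrable_on_def)

lemma linear_qd_system: "linear (qd_system p Q \<mu> t)"
  unfolding qd_system_def[abs_def]
  by (rule linearI)
    (simp_all add: linear_add[OF matrix_vector_mul_linear] linear_scale[OF matrix_vector_mul_linear]
      linear_add[OF linear_vector_scalar_mult] linear_scale[OF linear_vector_scalar_mult] algebra_simps)

lemma qd_system_measurable:
  assumes "admissible_coeffs a b p Q"
  shows "(\<lambda>t. qd_system p Q \<mu> t v) \<in> borel_measurable (lebesgue_on {a..b})"
proof -
  have mv: "(\<lambda>t. M t *v w) \<in> borel_measurable (lebesgue_on {a..b})"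
    if "M absolutely_integrable_on {a..b}" for M :: "real \<Rightarrow> complex^'a^'a" and w
  proof (rule measurable_compose[of M _ borel])
    show "M \<in> borel_measurable (lebesgue_on {a..b})"
      using that by (intro absolutely_integrable_imp_borel_measurable) auto
    show "(\<lambda>M::complex^'a^'a. M *v w) \<in> borel_measurable borel"
      by (intro borel_measurable_continuous_onI linear_continuous_on linear_conv_bounded_linear[THEN iffD1] linear_matrix_argument)
  qed
  show ?thesis unfolding qd_system_def
    using mv[OF admissible_coeffs_integrable(1)[OF assms]] mv[OF admissible_coeffs_integrable(2)[OF assms]]
      mv[OF admissible_coeffs_integrable(3)[OF assms]] mv[OF admissible_coeffs_integrable(4)[OF assms]]
    by (intro borel_measurable_Pair borel_measurable_add borel_measurable_diff borel_measurable_uminus) auto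
qed

lemma integrable_qd_system:
  assumes "a \<le> b" "admissible_coeffs a b p Q"
  shows "integrable_system a b (qd_system p Q \<mu>) (qd_bound p Q \<mu>)"
  unfolding integrable_system_def
  using assms qd_bound_integrable[OF assms(2)] linear_qd_system norm_qd_system_le qd_system_measurable[OF assms(2)]
  by (auto simp: qd_bound_def)

lemma qd_distance_integrable:
  assumes "admissible_coeffs a b p Q" "admissible_coeffs a b p' Q'"
  shows "qd_distance p Q p' Q' integrable_on {a..b}"
    and "integral {a..b} (qd_distance p Q p' Q') =
      L1_norm a b (\<lambda>t. matrix_inv (p' t) ** Q' t - matrix_inv (p t) ** Q t) +
      L1_norm a b (\<lambda>t. matrix_inv (p' t) - matrix_inv (p t)) +
      L1_norm a b (\<lambda>t. Q' t ** matrix_inv (p' t) ** Q' t - Q t ** matrix_inv (p t) ** Q t) +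
      L1_norm a b (\<lambda>t. Q' t ** matrix_inv (p' t) - Q t ** matrix_inv (p t))"
proof -
  note 1 = admissible_coeffs_integrable[OF assms(1)] and 2 = admissible_coeffs_integrable[OF assms(2)]
  have n: "(\<lambda>t. norm (f t)) integrable_on {a..b}" "L1_norm a b f = integral {a..b} (\<lambda>t. norm (f t))"
    if "f absolutely_integrable_on {a..b}" for f :: "real \<Rightarrow> complex^'a^'a"
    using that integral_leb_eq[of a b "\<lambda>t. norm (f t)"] integrable_norm[of "leb a b" f]
    by (auto simp: L1_norm_def integrable_leb_iff absolutely_integrable_on_def)
  have d: "(\<lambda>t. matrix_inv (p' t) ** Q' t - matrix_inv (p t) ** Q t) absolutely_integrable_on {a..b}"
    "(\<lambda>t. matrix_inv (p' t) - matrix_inv (p t)) absolutely_integrable_on {a..b}"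
    "(\<lambda>t. Q' t ** matrix_inv (p' t) ** Q' t - Q t ** matrix_inv (p t) ** Q t) absolutely_integrable_on {a..b}"
    "(\<lambda>t. Q' t ** matrix_inv (p' t) - Q t ** matrix_inv (p t)) absolutely_integrable_on {a..b}"
    using 1 2 by (auto intro: set_integral_diff)
  show "qd_distance p Q p' Q' integrable_on {a..b}" unfolding qd_distance_def[abs_def]
    by (intro integrable_add n(1) d)
  show "integral {a..b} (qd_distance p Q p' Q') =
      L1_norm a b (\<lambda>t. matrix_inv (p' t) ** Q' t - matrix_inv (p t) ** Q t) +
      L1_norm a b (\<lambda>t. matrix_inv (p' t) - matrix_inv (p t)) +
      L1_norm a b (\<lambda>t. Q' t ** matrix_inv (p' t) ** Q' t - Q t ** matrix_inv (p t) ** Q t) +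
      L1_norm a b (\<lambda>t. Q' t ** matrix_inv (p' t) - Q t ** matrix_inv (p t))"
    unfolding qd_distance_def[abs_def] n(2)[OF d(1)] n(2)[OF d(2)] n(2)[OF d(3)] n(2)[OF d(4)]
    by (subst integral_add integral_add; (intro integrable_add n(1) d)?)+ simp
qed

section \<open>The operator graph and the boundary value problem\<close>

lemma absolutely_continuous_fun_subinterval:
  assumes "absolutely_continuous_fun a b f" "t \<le> b"
  shows "absolutely_continuous_fun a t f"
proof -
  have "S \<subseteq> {a..b}" if "S \<subseteq> {a..t}" for S using that assms(2) by auto
  then show ?thesis using assms(1) unfolding absolutely_continuous_fun_def by meson
qed

lemma forcing_absolutely_integrable:
  fixes f :: "real \<Rightarrow> 'v::euclidean_space"
  assumes "f absolutely_integrable_on {a..b}"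
  shows "(\<lambda>t. (0 :: 'w::euclidean_space, - f t)) absolutely_integrable_on {a..b}"
proof -
  have "bounded_linear (\<lambda>x::'v. (0 :: 'w, - x))"
    by (intro bounded_linear_Pair bounded_linear_zero bounded_linear_minus bounded_linear_ident)
  from absolutely_integrable_linear[OF assms this] show ?thesis by (simp add: o_def)
qed

text \<open>
  Solutions of the boundary value problem yield elements of the operator graph. The derivatives almost
  everywhere come from the differentiation theorem.
\<close>

lemma bvp_solution_in_L_bdry:
  assumes ab: "a < b" and adm: "admissible_coeffs a b p Q" and f: "f \<in> L2 a b"
    and Y: "bvp_solution a b (qd_system p Q \<mu>) (bdry_map \<alpha>) (bdry_map \<beta>) (\<lambda>t. (0, - f t)) Y"
  shows "quasi_deriv1 a b p Q (\<lambda>t. fst (Y t)) (\<lambda>t. snd (Y t))"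
    and "(\<lambda>t. fst (Y t), \<lambda>t. f t + \<mu> *s fst (Y t)) \<in> L_bdry a b p Q \<alpha> \<beta>"
proof -
  define y where "y t = fst (Y t)" for t
  define u where "u t = snd (Y t)" for t
  define h where "h s = qd_system p Q \<mu> s (Y s) + (0, - f s)" for s
  have cY: "continuous_on {a..b} Y" and eq: "\<And>t. t \<in> {a..b} \<Longrightarrow> Y t = Y a + integral {a..t} h"
    and bc: "bdry_map \<alpha> (Y a) + bdry_map \<beta> (Y b) = 0"
    using Y unfolding bvp_solution_def solves_def h_def by blast+
  have sys: "integrable_system a b (qd_system p Q \<mu>) (qd_bound p Q \<mu>)"
    using ab by (intro integrable_qd_system adm) simp
  have h: "h absolutely_integrable_on {a..b}" unfolding h_def
    by (intro set_integral_add integrable_system_compose[OF sys cY] forcing_absolutely_integrable L2_Cauchy_Schwarz(1)[OF ab f])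
  have acY: "absolutely_continuous_fun a b Y"
  proof (rule absolutely_continuous_fun_dominated[OF absolutely_continuous_fun_integral[OF h, of "Y a"]])
    fix s t assume "a \<le> s" "s \<le> t" "t \<le> b"
    then have "Y s = Y a + integral {a..s} h" "Y t = Y a + integral {a..t} h" using eq[of s] eq[of t] by auto
    then show "norm (Y t - Y s) \<le> 1 * norm (Y a + integral {a..t} h - (Y a + integral {a..s} h))" by simp
  qed simp
  have "norm (y t - y s) \<le> 1 * norm (Y t - Y s)" "norm (u t - u s) \<le> 1 * norm (Y t - Y s)" for s t
    using norm_fst_le_norm[of "Y t - Y s"] norm_snd_le_norm[of "Y t - Y s"] by (simp_all add: y_def u_def)
  then have acy: "absolutely_continuous_fun a b y" and acu: "absolutely_continuous_fun a b u"
    by (auto intro: absolutely_continuous_fun_dominated[OF acY zero_le_one])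
  have hi: "h integrable_on {a..b}" using h by (simp add: absolutely_integrable_on_def)
  have "AE t in leb a b. (Y has_vector_derivative h t) (at t)"
    unfolding AE_leb_iff
  proof (intro exI conjI ballI)
    let ?N = "{x\<in>{a<..<b}. \<not> ((\<lambda>t. integral {a..t} h) has_vector_derivative h x) (at x)}"
    show "negligible ?N" by (rule Lebesgue_differentiation[OF hi])
    fix t assume t: "t \<in> {a<..<b} - ?N"
    then have d: "((\<lambda>t. Y a + integral {a..t} h) has_vector_derivative 0 + h t) (at t)"
      by (intro has_vector_derivative_add has_vector_derivative_const) auto
    show "(Y has_vector_derivative h t) (at t)"
    proof (rule has_vector_derivative_transform_within_open[OF d[unfolded add_0], of "{a<..<b}"])
      fix s assume "s \<in> {a<..<b}"
      then show "Y a + integral {a..s} h = Y s" using eq[of s] by simp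
    qed (use t in auto)
  qed
  then have der: "AE t in leb a b. (y has_vector_derivative fst (h t)) (at t) \<and> (u has_vector_derivative snd (h t)) (at t)"
  proof eventually_elim
    case (elim t)
    then have "(Y has_derivative (\<lambda>r. r *\<^sub>R h t)) (at t)" by (simp add: has_vector_derivative_def)
    from has_derivative_fst[OF this] has_derivative_snd[OF this] show ?case
      by (simp add: has_vector_derivative_def y_def[abs_def] u_def[abs_def])
  qed
  have h12: "fst (h t) = (matrix_inv (p t) ** Q t) *v y t + matrix_inv (p t) *v u t"
    "snd (h t) = - ((Q t ** matrix_inv (p t) ** Q t) *v y t) - (Q t ** matrix_inv (p t)) *v u t - \<mu> *s y t - f t" for t
    by (simp_all add: h_def qd_system_def y_def u_def)
  have inv: "AE t in leb a b. invertible (p t)" using adm by (simp add: admissible_coeffs_def)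
  have q1: "quasi_deriv1 a b p Q y u" unfolding quasi_deriv1_def
  proof (intro conjI acu)
    show "AE t in leb a b. \<exists>y'. (y has_vector_derivative y') (at t) \<and> u t = p t *v y' - Q t *v y t"
      using der inv
    proof eventually_elim
      case (elim t)
      have "p t *v fst (h t) - Q t *v y t = u t"
        unfolding h12 using matrix_inv_mult(1)[OF elim(2)]
        by (simp add: matrix_vector_right_distrib matrix_vector_mul_assoc matrix_mul_assoc)
      then show ?case using elim(1) by metis
    qed
  qed
  then show "quasi_deriv1 a b p Q (\<lambda>t. fst (Y t)) (\<lambda>t. snd (Y t))" by (simp add: y_def[abs_def] u_def[abs_def])
  have q2: "quasi_deriv2 a b p Q y u (\<lambda>t. - (f t + \<mu> *s y t))" unfolding quasi_deriv2_def
    using der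
  proof eventually_elim
    case (elim t)
    show ?case using elim by (intro exI[of _ "snd (h t)"]) (simp add: h12)
  qed
  have yL2: "y \<in> L2 a b" by (rule L2_continuous[OF absolutely_continuous_fun_imp_continuous_on[OF acy]])
  have gL2: "(\<lambda>t. f t + \<mu> *s y t) \<in> L2 a b" by (rule L2_add_scaled[OF f yL2])
  have "(y, \<lambda>t. f t + \<mu> *s y t) \<in> L_max a b p Q"
    unfolding L_max_def using yL2 gL2 acy q1 q2 by blast
  moreover have "\<alpha> *v bdry_vec y u a + \<beta> *v bdry_vec y u b = 0"
    unfolding bdry_condition_iff using bc by (simp add: y_def u_def)
  ultimately have "(y, \<lambda>t. f t + \<mu> *s y t) \<in> L_bdry a b p Q \<alpha> \<beta>"
    unfolding L_bdry_def using q1 by blast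
  then show "(\<lambda>t. fst (Y t), \<lambda>t. f t + \<mu> *s fst (Y t)) \<in> L_bdry a b p Q \<alpha> \<beta>"
    by (simp add: y_def[abs_def])
qed

text \<open>
  The graph of the operator refers to the quasi-derivative in two separate existential statements,
  which therefore speak of the same function.
\<close>

lemma quasi_deriv1_unique:
  assumes ab: "a < b" and "quasi_deriv1 a b p Q y u" "quasi_deriv1 a b p Q y u'" and t: "t \<in> {a..b}"
  shows "u t = u' t"
proof (rule continuous_AE_eq_imp_eq[OF ab _ _ _ t])
  show "continuous_on {a..b} u" "continuous_on {a..b} u'"
    using assms(2,3) by (auto simp: quasi_deriv1_def intro: absolutely_continuous_fun_imp_continuous_on)
  have "AE t in leb a b. \<exists>y'. (y has_vector_derivative y') (at t) \<and> u t = p t *v y' - Q t *v y t"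
    "AE t in leb a b. \<exists>y'. (y has_vector_derivative y') (at t) \<and> u' t = p t *v y' - Q t *v y t"
    using assms(2,3) by (auto simp: quasi_deriv1_def)
  then show "AE t in leb a b. u t = u' t"
  proof eventually_elim
    case (elim t)
    then show ?case using vector_derivative_unique_at by metis
  qed
qed

text \<open>
  Conversely, every solution of the operator equation solves the boundary value problem in integral
  form, by absolute continuity.
\<close>

lemma L_bdry_imp_bvp_solution:
  assumes ab: "a < b" and adm: "admissible_coeffs a b p Q" and f: "f \<in> L2 a b"
    and yg: "(y, g) \<in> L_bdry a b p Q \<alpha> \<beta>" and ae: "AE t in leb a b. g t - \<mu> *s y t = f t"
  obtains u where "bvp_solution a b (qd_system p Q \<mu>) (bdry_map \<alpha>) (bdry_map \<beta>) (\<lambda>t. (0, - f t)) (\<lambda>t. (y t, u t))"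
proof -
  from yg obtain u u' where acy: "absolutely_continuous_fun a b y" and u: "quasi_deriv1 a b p Q y u"
    and u2: "quasi_deriv2 a b p Q y u (\<lambda>t. - g t)" and u': "quasi_deriv1 a b p Q y u'"
    and bc': "\<alpha> *v bdry_vec y u' a + \<beta> *v bdry_vec y u' b = 0"
    unfolding L_bdry_def L_max_def by blast
  have "u a = u' a" "u b = u' b" using ab by (auto intro!: quasi_deriv1_unique[OF ab u u'])
  then have bc: "bdry_map \<alpha> (y a, u a) + bdry_map \<beta> (y b, u b) = 0"
    using bc' unfolding bdry_condition_iff by simp
  have acu: "absolutely_continuous_fun a b u" using u by (simp add: quasi_deriv1_def)
  define Y where "Y t = (y t, u t)" for t
  define h where "h s = qd_system p Q \<mu> s (Y s) + (0, - f s)" for s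
  have cY: "continuous_on {a..b} Y" unfolding Y_def
    by (intro continuous_on_Pair absolutely_continuous_fun_imp_continuous_on acy acu)
  have sys: "integrable_system a b (qd_system p Q \<mu>) (qd_bound p Q \<mu>)"
    using ab by (intro integrable_qd_system adm) simp
  have h: "h absolutely_integrable_on {a..b}" unfolding h_def
    by (intro set_integral_add integrable_system_compose[OF sys cY] forcing_absolutely_integrable L2_Cauchy_Schwarz(1)[OF ab f])
  have inv: "AE t in leb a b. invertible (p t)" using adm by (simp add: admissible_coeffs_def)
  have h12: "fst (h t) = (matrix_inv (p t) ** Q t) *v y t + matrix_inv (p t) *v u t"
    "snd (h t) = - ((Q t ** matrix_inv (p t) ** Q t) *v y t) - (Q t ** matrix_inv (p t)) *v u t - \<mu> *s y t - f t" for t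
    by (simp_all add: h_def qd_system_def Y_def)
  have d1: "AE t in leb a b. \<exists>y'. (y has_vector_derivative y') (at t) \<and> u t = p t *v y' - Q t *v y t"
    using u by (simp add: quasi_deriv1_def)
  have d2: "AE t in leb a b. \<exists>v. (u has_vector_derivative v) (at t) \<and>
        - g t = v + (Q t ** matrix_inv (p t)) *v u t + (Q t ** matrix_inv (p t) ** Q t) *v y t"
    using u2 by (simp add: quasi_deriv2_def)
  have "AE t in leb a b. (y has_vector_derivative fst (h t)) (at t) \<and> (u has_vector_derivative snd (h t)) (at t)"
    using d1 d2 inv ae
  proof eventually_elim
    case (elim t)
    then obtain y' v where y': "(y has_vector_derivative y') (at t)" "u t = p t *v y' - Q t *v y t"
      and v: "(u has_vector_derivative v) (at t)"
        "- g t = v + (Q t ** matrix_inv (p t)) *v u t + (Q t ** matrix_inv (p t) ** Q t) *v y t" by blast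
    have "matrix_inv (p t) *v u t = y' - (matrix_inv (p t) ** Q t) *v y t"
      using matrix_inv_mult(2)[OF elim(3)]
      by (simp add: y'(2) matrix_vector_mult_diff_distrib matrix_vector_mul_assoc)
    then have "fst (h t) = y'" by (simp add: h12)
    moreover have "snd (h t) = v"
    proof -
      have "v = - g t - (Q t ** matrix_inv (p t)) *v u t - (Q t ** matrix_inv (p t) ** Q t) *v y t" using v(2) by simp
      moreover have "g t = f t + \<mu> *s y t" using elim(4) by (simp add: algebra_simps)
      ultimately show ?thesis by (simp add: h12)
    qed
    ultimately show ?case using y'(1) v(1) by simp
  qed
  then obtain N where N: "negligible N" and der: "\<And>t. t \<in> {a<..<b} - N \<Longrightarrow> (y has_vector_derivative fst (h t)) (at t)"
    "\<And>t. t \<in> {a<..<b} - N \<Longrightarrow> (u has_vector_derivative snd (h t)) (at t)"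
    unfolding AE_leb_iff by blast
  have "Y t = Y a + integral {a..t} h" if t: "t \<in> {a..b}" for t
  proof -
    have hi: "h integrable_on {a..t}"
      using h t by (auto simp: absolutely_integrable_on_def intro: integrable_subinterval_real)
    have 1: "((\<lambda>s. fst (h s)) has_integral y t - y a) {a..t}"
      by (rule FTC_absolutely_continuous_fun[OF absolutely_continuous_fun_subinterval[OF acy] _ N der(1)]) (use t in auto)
    have 2: "((\<lambda>s. snd (h s)) has_integral u t - u a) {a..t}"
      by (rule FTC_absolutely_continuous_fun[OF absolutely_continuous_fun_subinterval[OF acu] _ N der(2)]) (use t in auto)
    have "fst (integral {a..t} h) = y t - y a"
      using integral_linear[OF hi bounded_linear_fst] integral_unique[OF 1] by (simp add: o_def)
    moreover have "snd (integral {a..t} h) = u t - u a"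
      using integral_linear[OF hi bounded_linear_snd] integral_unique[OF 2] by (simp add: o_def)
    ultimately show ?thesis by (simp add: prod_eq_iff Y_def)
  qed
  then have "solves a b (qd_system p Q \<mu>) (\<lambda>t. (0, - f t)) Y"
    using cY unfolding solves_def h_def by blast
  then have "bvp_solution a b (qd_system p Q \<mu>) (bdry_map \<alpha>) (bdry_map \<beta>) (\<lambda>t. (0, - f t)) Y"
    using bc by (simp add: bvp_solution_def Y_def)
  then show thesis using that unfolding Y_def by blast
qed

section \<open>Resolvents\<close>

lemma bvp_solution_diff:
  assumes A: "integrable_system a b A k" and F: "F absolutely_integrable_on {a..b}"
    and lin: "linear \<alpha>" "linear \<beta>"
    and Y: "bvp_solution a b A \<alpha> \<beta> F Y" and Z: "bvp_solution a b A \<alpha> \<beta> F Z"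
  shows "bvp_solution a b A \<alpha> \<beta> (\<lambda>_. 0) (\<lambda>t. Y t - Z t)"
proof -
  have "\<alpha> (Y a - Z a) + \<beta> (Y b - Z b) = (\<alpha> (Y a) + \<beta> (Y b)) - (\<alpha> (Z a) + \<beta> (Z b))"
    by (simp add: linear_diff[OF lin(1)] linear_diff[OF lin(2)])
  then show ?thesis
    using solves_diff[OF A F] Y Z by (simp add: bvp_solution_def)
qed

lemma forcing_L2:
  assumes "a < b" "f \<in> L2 a b"
  shows "(\<lambda>t. (0 :: complex^'s::finite, - f t)) absolutely_integrable_on {a..b}"
    and "integral {a..b} (\<lambda>t. norm (0 :: complex^'s, - f t)) \<le> sqrt (b - a) * L2_norm a b f"
  using forcing_absolutely_integrable[OF L2_Cauchy_Schwarz(1)[OF assms]] L2_Cauchy_Schwarz(2)[OF assms]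
  by (simp_all add: norm_Pair)

lemma L2_norm_nonneg: "0 \<le> L2_norm a b f"
  by (simp add: L2_norm_def)

text \<open>
  A homogeneous solution \<open>Y = (y, u)\<close> belongs to the kernel of \<open>L - \<mu>\<close>, hence \<open>y\<close> vanishes almost
  everywhere and, by continuity, everywhere. Then \<open>u = p y' - Q y\<close> vanishes as well.
\<close>

lemma resolvent_set_imp_bvp_injective:
  assumes ab: "a < b" and adm: "admissible_coeffs a b p Q"
    and \<mu>: "\<mu> \<in> resolvent_set a b (L_bdry a b p Q \<alpha> \<beta>)"
    and Y: "bvp_solution a b (qd_system p Q \<mu>) (bdry_map \<alpha>) (bdry_map \<beta>) (\<lambda>_. 0) Y"
  shows "Y a = 0"
proof -
  have L20: "(\<lambda>_. 0) \<in> L2 a b" by (rule L2_continuous) simp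
  have in_L: "(\<lambda>t. fst (Z t), \<lambda>t. 0 + \<mu> *s fst (Z t)) \<in> L_bdry a b p Q \<alpha> \<beta>"
    and qd: "quasi_deriv1 a b p Q (\<lambda>t. fst (Z t)) (\<lambda>t. snd (Z t))"
    if "bvp_solution a b (qd_system p Q \<mu>) (bdry_map \<alpha>) (bdry_map \<beta>) (\<lambda>_. 0) Z" for Z
    using bvp_solution_in_L_bdry[OF ab adm L20, of \<mu> \<alpha> \<beta> Z] that by (simp_all add: zero_prod_def)
  have zero: "bvp_solution a b (qd_system p Q \<mu>) (bdry_map \<alpha>) (bdry_map \<beta>) (\<lambda>_. 0) (\<lambda>_. 0)"
    by (simp add: bvp_solution_def solves_def linear_0[OF linear_qd_system] linear_0[OF linear_bdry_map])
  define y u where "y t = fst (Y t)" and "u t = snd (Y t)" for t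
  have cont: "continuous_on {a..b} Y" using Y by (simp add: bvp_solution_def solves_def)
  have uniq: "\<forall>(y, g)\<in>L_bdry a b p Q \<alpha> \<beta>. \<forall>(z, h)\<in>L_bdry a b p Q \<alpha> \<beta>.
            (AE t in leb a b. g t - \<mu> *s y t = h t - \<mu> *s z t) \<longrightarrow> (AE t in leb a b. y t = z t)"
    using \<mu> by (simp add: resolvent_set_def)
  from uniq[rule_format, OF in_L[OF Y] , unfolded case_prod_conv, rule_format, OF in_L[OF zero], unfolded case_prod_conv, rule_format]
  have "AE t in leb a b. y t = 0" by (simp add: y_def)
  then have y0: "y t = 0" if "t \<in> {a..b}" for t
    using that unfolding y_def
    by (intro continuous_AE_eq_imp_eq[OF ab, where g="\<lambda>_. 0"] continuous_on_fst cont) auto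
  have "AE t in leb a b. \<exists>y'. (y has_vector_derivative y') (at t) \<and> u t = p t *v y' - Q t *v y t"
    using qd[OF Y] by (simp add: quasi_deriv1_def y_def[abs_def] u_def[abs_def])
  moreover have "AE t in leb a b. t \<in> {a<..<b}" by (rule AE_I2) simp
  ultimately have "AE t in leb a b. u t = 0"
  proof eventually_elim
    case (elim t)
    then obtain y' where y': "(y has_vector_derivative y') (at t)" "u t = p t *v y' - Q t *v y t" by blast
    have "(y has_vector_derivative 0) (at t)"
    proof (rule has_vector_derivative_transform_within_open[OF has_vector_derivative_const, of "{a<..<b}"])
      show "0 = y s" if "s \<in> {a<..<b}" for s using y0[of s] that by simp
    qed (use elim in auto)
    then have "y' = 0" using y'(1) vector_derivative_unique_at by blast
    then show ?case using y'(2) y0[of t] elim by simp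
  qed
  then have "u a = 0"
    unfolding u_def using ab
    by (intro continuous_AE_eq_imp_eq[OF ab, where g="\<lambda>_. 0"] continuous_on_snd cont) auto
  then show ?thesis using y0[of a] ab by (simp add: y_def u_def prod_eq_iff)
qed

text \<open>
  Unique solvability of the boundary value problem, with a uniform bound in terms of the \<open>L\<^sub>1\<close> norm of
  the right-hand side, implies that \<open>\<mu>\<close> belongs to the resolvent set.
\<close>

lemma resolvent_setI:
  assumes ab: "a < b" and adm: "admissible_coeffs a b p Q"
    and ex: "\<And>F. F absolutely_integrable_on {a..b}
      \<Longrightarrow> \<exists>Z. bvp_solution a b (qd_system p Q \<mu>) (bdry_map \<alpha>) (bdry_map \<beta>) F Z"
    and bd: "\<And>F Z t. \<lbrakk>F absolutely_integrable_on {a..b};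
        bvp_solution a b (qd_system p Q \<mu>) (bdry_map \<alpha>) (bdry_map \<beta>) F Z; t \<in> {a..b}\<rbrakk>
      \<Longrightarrow> norm (Z t) \<le> K * integral {a..b} (\<lambda>s. norm (F s))"
    and K: "0 < K"
  shows "\<mu> \<in> resolvent_set a b (L_bdry a b p Q \<alpha> \<beta>)"
proof -
  let ?L = "L_bdry a b p Q \<alpha> \<beta>"
  let ?bvp = "bvp_solution a b (qd_system p Q \<mu>) (bdry_map \<alpha>) (bdry_map \<beta>)"
  have sys: "integrable_system a b (qd_system p Q \<mu>) (qd_bound p Q \<mu>)"
    using ab by (intro integrable_qd_system adm) simp
  have L2_L: "y \<in> L2 a b \<and> g \<in> L2 a b" if "(y, g) \<in> ?L" for y g
    using that by (auto simp: L_bdry_def L_max_def)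
  have rhs: "(\<lambda>t. g t - \<mu> *s y t) \<in> L2 a b" if "(y, g) \<in> ?L" for y g
    using L2_add_scaled[of g a b y "- \<mu>"] L2_L[OF that] by simp
  have 1: "\<exists>(y, g)\<in>?L. AE t in leb a b. g t - \<mu> *s y t = f t" if f: "f \<in> L2 a b" for f
  proof -
    obtain Z where Z: "?bvp (\<lambda>t. (0, - f t)) Z" using ex[OF forcing_L2(1)[OF ab f]] by blast
    show ?thesis
      by (rule bexI[OF _ bvp_solution_in_L_bdry(2)[OF ab adm f Z]]) simp
  qed
  have 2: "AE t in leb a b. y t = z t"
    if yg: "(y, g) \<in> ?L" and zh: "(z, h) \<in> ?L" and eq: "AE t in leb a b. g t - \<mu> *s y t = h t - \<mu> *s z t" for y g z h
  proof -
    define f where "f t = g t - \<mu> *s y t" for t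
    have f: "f \<in> L2 a b" unfolding f_def by (rule rhs[OF yg])
    obtain u where u: "?bvp (\<lambda>t. (0, - f t)) (\<lambda>t. (y t, u t))"
      by (rule L_bdry_imp_bvp_solution[OF ab adm f yg, of \<mu>]) (auto simp: f_def)
    have "AE t in leb a b. h t - \<mu> *s z t = f t" using eq by eventually_elim (simp add: f_def)
    from L_bdry_imp_bvp_solution[OF ab adm f zh this]
    obtain v where v: "?bvp (\<lambda>t. (0, - f t)) (\<lambda>t. (z t, v t))" by blast
    have "?bvp (\<lambda>_. 0) (\<lambda>t. (y t, u t) - (z t, v t))"
      by (rule bvp_solution_diff[OF sys forcing_L2(1)[OF ab f] linear_bdry_map linear_bdry_map u v])
    from bd[OF absolutely_integrable_0 this] have "y t = z t" if "t \<in> {a..b}" for t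
      using that by (simp add: norm_le_zero_iff zero_prod_def)
    then show ?thesis by (intro AE_I2) simp
  qed
  have 3: "L2_norm a b y \<le> (b - a) * K * L2_norm a b (\<lambda>t. g t - \<mu> *s y t)" if yg: "(y, g) \<in> ?L" for y g
  proof -
    define f where "f t = g t - \<mu> *s y t" for t
    have f: "f \<in> L2 a b" unfolding f_def by (rule rhs[OF yg])
    obtain u where u: "?bvp (\<lambda>t. (0, - f t)) (\<lambda>t. (y t, u t))"
      by (rule L_bdry_imp_bvp_solution[OF ab adm f yg, of \<mu>]) (auto simp: f_def)
    have "norm (y t) \<le> K * (sqrt (b - a) * L2_norm a b f)" if t: "t \<in> {a<..<b}" for t
    proof -
      have "norm (y t) \<le> norm (y t, u t)" by (rule norm_fst_le)
      also have "\<dots> \<le> K * integral {a..b} (\<lambda>t. norm (0 :: complex^'a, - f t))"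
        by (rule bd[OF forcing_L2(1)[OF ab f] u]) (use t in auto)
      also have "\<dots> \<le> K * (sqrt (b - a) * L2_norm a b f)"
        using K by (intro mult_left_mono forcing_L2(2)[OF ab f]) auto
      finally show ?thesis .
    qed
    then have "L2_norm a b y \<le> sqrt (b - a) * (K * (sqrt (b - a) * L2_norm a b f))"
      using K ab by (intro L2_norm_le[OF ab]) (auto intro!: mult_nonneg_nonneg L2_norm_nonneg)
    also have "\<dots> = (sqrt (b - a) * sqrt (b - a)) * K * L2_norm a b f" by (simp only: mult_ac)
    also have "\<dots> = (b - a) * K * L2_norm a b f" using ab by simp
    finally show ?thesis by (simp only: f_def[abs_def])
  qed
  show ?thesis unfolding resolvent_set_def using 1 2 3 by blast
qed

text \<open>
  The resolvent is defined by a choice, but any chosen function is the first component of a solution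
  of the boundary value problem.
\<close>

lemma resolvent_bvp_solution:
  assumes ab: "a < b" and adm: "admissible_coeffs a b p Q"
    and \<mu>: "\<mu> \<in> resolvent_set a b (L_bdry a b p Q \<alpha> \<beta>)" and f: "f \<in> L2 a b"
  obtains u where "bvp_solution a b (qd_system p Q \<mu>) (bdry_map \<alpha>) (bdry_map \<beta>) (\<lambda>t. (0, - f t))
     (\<lambda>t. (resolvent a b (L_bdry a b p Q \<alpha> \<beta>) \<mu> f t, u t))"
proof -
  have "\<exists>(y, g)\<in>L_bdry a b p Q \<alpha> \<beta>. AE t in leb a b. g t - \<mu> *s y t = f t"
    using \<mu> f by (simp add: resolvent_set_def)
  then have "\<exists>y g. (y, g) \<in> L_bdry a b p Q \<alpha> \<beta> \<and> (AE t in leb a b. g t - \<mu> *s y t = f t)" by blast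
  then have "\<exists>g. (resolvent a b (L_bdry a b p Q \<alpha> \<beta>) \<mu> f, g) \<in> L_bdry a b p Q \<alpha> \<beta> \<and>
      (AE t in leb a b. g t - \<mu> *s resolvent a b (L_bdry a b p Q \<alpha> \<beta>) \<mu> f t = f t)"
    unfolding resolvent_def by (rule someI_ex)
  then obtain g where "(resolvent a b (L_bdry a b p Q \<alpha> \<beta>) \<mu> f, g) \<in> L_bdry a b p Q \<alpha> \<beta>"
      "AE t in leb a b. g t - \<mu> *s resolvent a b (L_bdry a b p Q \<alpha> \<beta>) \<mu> f t = f t" by blast
  from L_bdry_imp_bvp_solution[OF ab adm f this] show ?thesis using that by blast
qed

theorem theorem2:
  fixes a b \<epsilon>\<^sub>0 :: real
    and p Q :: "real \<Rightarrow> real \<Rightarrow> complex^'s::finite^'s"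
    and \<alpha> \<beta> :: "real \<Rightarrow> complex^('s + 's)^('s + 's)"
  assumes "a < b" and "0 < \<epsilon>\<^sub>0"
    and "\<And>\<epsilon>. \<epsilon> \<in> {0..\<epsilon>\<^sub>0} \<Longrightarrow> admissible_coeffs a b (p \<epsilon>) (Q \<epsilon>)"
    and "resolvent_set a b (L_bdry a b (p 0) (Q 0) (\<alpha> 0) (\<beta> 0)) \<noteq> {}"
    and "((\<lambda>\<epsilon>. L1_norm a b (\<lambda>t. matrix_inv (p \<epsilon> t) - matrix_inv (p 0 t))) \<longlongrightarrow> 0) (at_right 0)"
    and "((\<lambda>\<epsilon>. L1_norm a b (\<lambda>t. matrix_inv (p \<epsilon> t) ** Q \<epsilon> t - matrix_inv (p 0 t) ** Q 0 t))
            \<longlongrightarrow> 0) (at_right 0)"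
    and "((\<lambda>\<epsilon>. L1_norm a b (\<lambda>t. Q \<epsilon> t ** matrix_inv (p \<epsilon> t) - Q 0 t ** matrix_inv (p 0 t)))
            \<longlongrightarrow> 0) (at_right 0)"
    and "((\<lambda>\<epsilon>. L1_norm a b (\<lambda>t. Q \<epsilon> t ** matrix_inv (p \<epsilon> t) ** Q \<epsilon> t
                                   - Q 0 t ** matrix_inv (p 0 t) ** Q 0 t))
            \<longlongrightarrow> 0) (at_right 0)"
    and "(\<alpha> \<longlongrightarrow> \<alpha> 0) (at_right 0)" and "(\<beta> \<longlongrightarrow> \<beta> 0) (at_right 0)"
  shows "norm_resolvent_converges a b (\<lambda>\<epsilon>. L_bdry a b (p \<epsilon>) (Q \<epsilon>) (\<alpha> \<epsilon>) (\<beta> \<epsilon>))"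
proof -
  note ab = assms(1) and adm = assms(3)
  have adm0: "admissible_coeffs a b (p 0) (Q 0)" using adm assms(2) by simp
  let ?L = "\<lambda>\<epsilon>. L_bdry a b (p \<epsilon>) (Q \<epsilon>) (\<alpha> \<epsilon>) (\<beta> \<epsilon>)"
  obtain \<mu> where \<mu>: "\<mu> \<in> resolvent_set a b (?L 0)" using assms(4) by blast
  let ?A = "\<lambda>\<epsilon>. qd_system (p \<epsilon>) (Q \<epsilon>) \<mu>"
  let ?P = "\<lambda>\<eta> \<epsilon>. bvp_perturbation a b (?A 0) (qd_bound (p 0) (Q 0) \<mu>) (bdry_map (\<alpha> 0)) (bdry_map (\<beta> 0)) \<eta>
      (?A \<epsilon>) (bdry_map (\<alpha> \<epsilon>)) (bdry_map (\<beta> \<epsilon>))"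
  let ?D = "\<lambda>\<epsilon>. qd_distance (p 0) (Q 0) (p \<epsilon>) (Q \<epsilon>)"
  have sys0: "integrable_system a b (?A 0) (qd_bound (p 0) (Q 0) \<mu>)"
    using ab by (intro integrable_qd_system adm0) simp
  have inj: "\<forall>Y. bvp_solution a b (?A 0) (bdry_map (\<alpha> 0)) (bdry_map (\<beta> 0)) (\<lambda>_. 0) Y \<longrightarrow> Y a = 0"
    using resolvent_set_imp_bvp_injective[OF ab adm0 \<mu>] by blast
  have small: "\<forall>\<^sub>F \<epsilon> in at_right 0. \<epsilon> \<in> {0..\<epsilon>\<^sub>0}"
    using assms(2) by (auto simp: eventually_at_right intro!: exI[of _ \<epsilon>\<^sub>0])
  have pert: "\<forall>\<^sub>F \<epsilon> in at_right 0. ?P \<eta> \<epsilon>" if \<eta>: "\<eta> > 0" for \<eta>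
  proof -
    obtain C where C: "C > 0"
      "\<And>\<gamma> \<gamma>' v. norm (bdry_map \<gamma>' v - bdry_map \<gamma> v :: (complex^'s) \<times> _) \<le> C * norm (\<gamma>' - \<gamma>) * norm v"
      using bdry_map_diff_le by blast
    have "((\<lambda>\<epsilon>. L1_norm a b (\<lambda>t. matrix_inv (p \<epsilon> t) ** Q \<epsilon> t - matrix_inv (p 0 t) ** Q 0 t) +
        L1_norm a b (\<lambda>t. matrix_inv (p \<epsilon> t) - matrix_inv (p 0 t)) +
        L1_norm a b (\<lambda>t. Q \<epsilon> t ** matrix_inv (p \<epsilon> t) ** Q \<epsilon> t - Q 0 t ** matrix_inv (p 0 t) ** Q 0 t) +
        L1_norm a b (\<lambda>t. Q \<epsilon> t ** matrix_inv (p \<epsilon> t) - Q 0 t ** matrix_inv (p 0 t))) \<longlongrightarrow> 0 + 0 + 0 + 0) (at_right 0)"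
      by (intro tendsto_add assms)
    then have L1: "\<forall>\<^sub>F \<epsilon> in at_right 0. L1_norm a b (\<lambda>t. matrix_inv (p \<epsilon> t) ** Q \<epsilon> t - matrix_inv (p 0 t) ** Q 0 t) +
        L1_norm a b (\<lambda>t. matrix_inv (p \<epsilon> t) - matrix_inv (p 0 t)) +
        L1_norm a b (\<lambda>t. Q \<epsilon> t ** matrix_inv (p \<epsilon> t) ** Q \<epsilon> t - Q 0 t ** matrix_inv (p 0 t) ** Q 0 t) +
        L1_norm a b (\<lambda>t. Q \<epsilon> t ** matrix_inv (p \<epsilon> t) - Q 0 t ** matrix_inv (p 0 t)) < \<eta>"
      using \<eta> by (intro order_tendstoD(2)) auto
    have \<eta>C: "\<eta> / C > 0" using \<eta> C by simp
    have \<alpha>: "\<forall>\<^sub>F \<epsilon> in at_right 0. norm (\<alpha> \<epsilon> - \<alpha> 0) < \<eta> / C"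
      using tendstoD[OF assms(9) \<eta>C] by (simp add: dist_norm)
    have \<beta>: "\<forall>\<^sub>F \<epsilon> in at_right 0. norm (\<beta> \<epsilon> - \<beta> 0) < \<eta> / C"
      using tendstoD[OF assms(10) \<eta>C] by (simp add: dist_norm)
    have bd: "norm (bdry_map \<gamma>' v - bdry_map \<gamma> v) \<le> \<eta> * norm v"
      if "norm (\<gamma>' - \<gamma>) < \<eta> / C" for \<gamma> \<gamma>' :: "complex^('s + 's)^('s + 's)" and v
    proof -
      have "C * norm (\<gamma>' - \<gamma>) \<le> \<eta>" using that C(1) by (simp add: field_simps)
      then show ?thesis using C(2)[of \<gamma>' v \<gamma>] mult_right_mono[of "C * norm (\<gamma>' - \<gamma>)" \<eta> "norm v"] by simp
    qed
    show ?thesis using small L1 \<alpha> \<beta>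
    proof eventually_elim
      case (elim \<epsilon>)
      note adm\<epsilon> = adm[OF elim(1)]
      have D: "?D \<epsilon> integrable_on {a..b}" by (rule qd_distance_integrable(1)[OF adm0 adm\<epsilon>])
      have D\<eta>: "integral {a..b} (?D \<epsilon>) \<le> \<eta>" unfolding qd_distance_integrable(2)[OF adm0 adm\<epsilon>] using elim(2) by simp
      have "integrable_system a b (?A \<epsilon>) (\<lambda>t. qd_bound (p 0) (Q 0) \<mu> t + ?D \<epsilon> t)"
        unfolding integrable_system_def
      proof (intro conjI ballI allI)
        show "a \<le> b" using ab by simp
        show "(\<lambda>t. qd_bound (p 0) (Q 0) \<mu> t + ?D \<epsilon> t) integrable_on {a..b}"
          by (intro integrable_add qd_bound_integrable adm0 D)
        show "linear (?A \<epsilon> t)" for t by (rule linear_qd_system)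
        show "0 \<le> qd_bound (p 0) (Q 0) \<mu> t + ?D \<epsilon> t" for t
          by (intro add_nonneg_nonneg qd_distance_nonneg) (simp add: qd_bound_def)
        show "(\<lambda>t. ?A \<epsilon> t v) \<in> borel_measurable (lebesgue_on {a..b})" for v by (rule qd_system_measurable[OF adm\<epsilon>])
        show "norm (?A \<epsilon> t v) \<le> (qd_bound (p 0) (Q 0) \<mu> t + ?D \<epsilon> t) * norm v" for t v
        proof -
          have "norm (?A \<epsilon> t v) \<le> norm (?A 0 t v) + norm (?A \<epsilon> t v - ?A 0 t v)" by (rule norm_triangle_sub)
          then show ?thesis
            using norm_qd_system_le[of "p 0" "Q 0" \<mu> t v] norm_qd_system_diff_le[of "p \<epsilon>" "Q \<epsilon>" \<mu> t v "p 0" "Q 0"]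
            by (simp add: algebra_simps)
        qed
      qed
      then show ?case unfolding bvp_perturbation_def
        by (intro conjI allI exI[of _ "?D \<epsilon>"] ballI linear_bdry_map bd[OF elim(3)] bd[OF elim(4)] D D\<eta>
            qd_distance_nonneg norm_qd_system_diff_le)
    qed
  qed
  have res: "\<forall>\<^sub>F \<epsilon> in at_right 0. \<mu> \<in> resolvent_set a b (?L \<epsilon>) \<and>
      (\<forall>f\<in>L2 a b. L2_norm a b (\<lambda>t. resolvent a b (?L \<epsilon>) \<mu> f t - resolvent a b (?L 0) \<mu> f t) \<le> (b - a) * e * L2_norm a b f)"
    if e: "e > 0" for e
  proof -
    obtain \<eta> K where \<eta>: "\<eta> > 0" and K: "K > 0" and
      ex: "\<And>A' \<alpha>' \<beta>' F. \<lbrakk>bvp_perturbation a b (?A 0) (qd_bound (p 0) (Q 0) \<mu>) (bdry_map (\<alpha> 0)) (bdry_map (\<beta> 0)) \<eta> A' \<alpha>' \<beta>';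
          F absolutely_integrable_on {a..b}\<rbrakk> \<Longrightarrow> \<exists>Z. bvp_solution a b A' \<alpha>' \<beta>' F Z" and
      bd: "\<And>A' \<alpha>' \<beta>' F Z t. \<lbrakk>bvp_perturbation a b (?A 0) (qd_bound (p 0) (Q 0) \<mu>) (bdry_map (\<alpha> 0)) (bdry_map (\<beta> 0)) \<eta> A' \<alpha>' \<beta>';
          F absolutely_integrable_on {a..b}; bvp_solution a b A' \<alpha>' \<beta>' F Z; t \<in> {a..b}\<rbrakk>
        \<Longrightarrow> norm (Z t) \<le> K * integral {a..b} (\<lambda>s. norm (F s))" and
      df: "\<And>A' \<alpha>' \<beta>' F Y Z t. \<lbrakk>bvp_perturbation a b (?A 0) (qd_bound (p 0) (Q 0) \<mu>) (bdry_map (\<alpha> 0)) (bdry_map (\<beta> 0)) \<eta> A' \<alpha>' \<beta>';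
          F absolutely_integrable_on {a..b}; bvp_solution a b (?A 0) (bdry_map (\<alpha> 0)) (bdry_map (\<beta> 0)) F Y;
          bvp_solution a b A' \<alpha>' \<beta>' F Z; t \<in> {a..b}\<rbrakk>
        \<Longrightarrow> norm (Z t - Y t) \<le> e * integral {a..b} (\<lambda>s. norm (F s))"
      by (rule bvp_stability[OF sys0 linear_bdry_map linear_bdry_map inj e]) (rule that)
    show ?thesis using small pert[OF \<eta>]
    proof eventually_elim
      case (elim \<epsilon>)
      note adm\<epsilon> = adm[OF elim(1)]
      have \<mu>\<epsilon>: "\<mu> \<in> resolvent_set a b (?L \<epsilon>)"
        by (rule resolvent_setI[OF ab adm\<epsilon> _ _ K]) (fact ex[OF elim(2)], fact bd[OF elim(2)])
      moreover have "L2_norm a b (\<lambda>t. resolvent a b (?L \<epsilon>) \<mu> f t - resolvent a b (?L 0) \<mu> f t) \<le> (b - a) * e * L2_norm a b f"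
        if f: "f \<in> L2 a b" for f
      proof -
        let ?r = "\<lambda>\<epsilon>. resolvent a b (?L \<epsilon>) \<mu> f"
        obtain u where u: "bvp_solution a b (?A 0) (bdry_map (\<alpha> 0)) (bdry_map (\<beta> 0)) (\<lambda>t. (0, - f t)) (\<lambda>t. (?r 0 t, u t))"
          using resolvent_bvp_solution[OF ab adm0 \<mu> f] by blast
        obtain v where v: "bvp_solution a b (?A \<epsilon>) (bdry_map (\<alpha> \<epsilon>)) (bdry_map (\<beta> \<epsilon>)) (\<lambda>t. (0, - f t)) (\<lambda>t. (?r \<epsilon> t, v t))"
          using resolvent_bvp_solution[OF ab adm\<epsilon> \<mu>\<epsilon> f] by blast
        have "norm (?r \<epsilon> t - ?r 0 t) \<le> e * (sqrt (b - a) * L2_norm a b f)" if t: "t \<in> {a<..<b}" for t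
        proof -
          have "norm (?r \<epsilon> t - ?r 0 t) \<le> norm ((?r \<epsilon> t, v t) - (?r 0 t, u t))"
            using norm_fst_le_norm[of "(?r \<epsilon> t, v t) - (?r 0 t, u t)"] by simp
          also have "\<dots> \<le> e * integral {a..b} (\<lambda>t. norm (0 :: complex^'s, - f t))"
            by (rule df[OF elim(2) forcing_L2(1)[OF ab f] u v]) (use t in auto)
          also have "\<dots> \<le> e * (sqrt (b - a) * L2_norm a b f)"
            using e by (intro mult_left_mono forcing_L2(2)[OF ab f]) auto
          finally show ?thesis .
        qed
        then have "L2_norm a b (\<lambda>t. ?r \<epsilon> t - ?r 0 t) \<le> sqrt (b - a) * (e * (sqrt (b - a) * L2_norm a b f))"
          using e ab by (intro L2_norm_le[OF ab]) (auto intro!: mult_nonneg_nonneg L2_norm_nonneg)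
        also have "\<dots> = (sqrt (b - a) * sqrt (b - a)) * e * L2_norm a b f" by (simp only: mult_ac)
        also have "\<dots> = (b - a) * e * L2_norm a b f" using ab by simp
        finally show ?thesis .
      qed
      ultimately show ?case by blast
    qed
  qed
  have "((\<lambda>\<epsilon>. L2_onorm a b (\<lambda>f t. resolvent a b (?L \<epsilon>) \<mu> f t - resolvent a b (?L 0) \<mu> f t)) \<longlongrightarrow> 0) (at_right 0)"
  proof (rule tendstoI)
    fix r :: real assume r: "r > 0"
    \<comment> \<open>The factor \<open>b - a\<close> comes from two comparisons of norms on the interval, each contributing its
      square root.\<close>
    define e where "e = r / 2 / (b - a)"
    have "b - a \<noteq> 0" using ab by simp
    then have e: "e > 0" "(b - a) * e = r / 2" unfolding e_def using r ab
      by (simp, metis nonzero_mult_div_cancel_left times_divide_eq_right)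
    show "\<forall>\<^sub>F \<epsilon> in at_right 0. dist (L2_onorm a b (\<lambda>f t. resolvent a b (?L \<epsilon>) \<mu> f t - resolvent a b (?L 0) \<mu> f t)) 0 < r"
      using res[OF e(1)]
    proof eventually_elim
      case (elim \<epsilon>)
      let ?T = "\<lambda>f t. resolvent a b (?L \<epsilon>) \<mu> f t - resolvent a b (?L 0) \<mu> f t"
      have le: "L2_norm a b (?T f) / L2_norm a b f \<le> r / 2" if "f \<in> L2 a b" for f
      proof (cases "L2_norm a b f = 0")
        case False
        then have "L2_norm a b f > 0" using L2_norm_nonneg[of a b f] by simp
        then show ?thesis using elim that e(2) by (simp add: pos_divide_le_eq)
      qed (use r in simp)
      have zero: "(\<lambda>_. 0) \<in> L2 a b" by (rule L2_continuous) simp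
      then have upper: "L2_onorm a b ?T \<le> r / 2" unfolding L2_onorm_def
        using le by (intro cSUP_least) auto
      have "0 \<le> L2_onorm a b ?T" unfolding L2_onorm_def
      proof (rule cSUP_upper2[OF _ zero])
        show "bdd_above ((\<lambda>f. L2_norm a b (?T f) / L2_norm a b f) ` L2 a b)"
          using le by (intro bdd_aboveI[of _ "r / 2"]) auto
      qed (simp add: L2_norm_nonneg)
      with upper r show ?case by simp
    qed
  qed
  moreover have "\<forall>\<^sub>F \<epsilon> in at_right 0. \<mu> \<in> resolvent_set a b (?L \<epsilon>)"
    using res[OF zero_less_one] by eventually_elim simp
  ultimately show ?thesis unfolding norm_resolvent_converges_def using \<mu> by blast
qed

end
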